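(* Suppose that (a) the set-valued map $K\setminus O\ni x\mapsto A(x)\subseteq A$ is compact-valued, upper hemicontinuous and weakly measurable; (b) the transition kernel $Q$ is strongly Feller on $\mathbb K$, i.e. $\mathbb K\ni(x,a)\mapsto\int_X Q(\mathrm dy|x,a)g(y)$ is continuous and bounded for every bounded measurable $g:X\to\mathbb R$; and (c) $\tau\wedge\tau'<\infty$ $\mathsf P^\pi_x$-almost surely for every Markov policy $\pi\in\Pi_M$ and every $x\in X$. Let $V^\star(x)=\sup_{\pi\in\Pi_M}\mathsf P^\pi_x(\tau<\tau',\ \tau<\infty)$. Then: (i) $V^\star$ is a (pointwise) bounded and measurable solution $\psi$ of the Bellman equation $$\psi(x)=\mathbf 1_O(x)+\mathbf 1_{K\setminus O}(x)\max_{a\in A(x)}\int_X Q(\mathrm dy|x,a)\,\mathbf 1_K(y)\,\psi(y)\qquad\text{for all }x\in X .$$ Moreover, $V^\star$ is minimal among the solutions in $\bar B\cap b\mathfrak B(X)^+$: $V^\star\in\bar B\cap b\mathfrak B(X)^+$, and $V^\star\le\psi$ pointwise for every solution $\psi\in\bar B\cap b\mathfrak B(X)^+$ of the Bellman equation. (ii) There exists a measurable selector $f_\star\in\mathbb F$ such that for each $x\in K\setminus O$ the action $f_\star(x)\in A(x)$ attains the maximum in the Bellman equation with $\psi=V^\star$, so that $$V^\star(x)=\begin{cases}1&\text{if }x\in O,\\ \int_K Q(\mathrm dy|x,f_\star(x))\,V^\star(y)&\text{if }x\in K\setminus O,\\ 0&\text{otherwise,}\end{cases}\qquad(\ast)$$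 and the deterministic stationary policy $f_\star^\infty$ is optimal, i.e. $V(f_\star^\infty,x)=V^\star(x)$ for all $x\in X$. Conversely, if $f_\star\in\mathbb F$ is such that $f_\star^\infty$ is optimal, then $f_\star$ satisfies $(\ast)$.
   Context: A Borel space is a Borel subset of a Polish space, with Borel $\sigma$-algebra $\mathfrak B(\cdot)$; "measurable" means Borel measurable. $X$ (states) and $A$ (actions) are nonempty Borel spaces; for each $x\in X$, $A(x)$ is a nonempty measurable subset of $A$ (feasible actions); the set $\mathbb K_X=\{(x,a):x\in X,\ a\in A(x)\}$ is measurable in $X\times A$ and contains the graph of a measurable function $X\to A$; $Q$ is a stochastic kernel on $X$ given $\mathbb K_X$. $O\subsetneq K$ are nonempty measurable subsets of $X$ (target set $O$, safe set $K$, cemetery set $X\setminus K$). $\mathbb N_0=\{0,1,2,\dots\}$, $a\wedge b=\min\{a,b\}$. Write $\mathbb K=\{(x,a):x\in K\setminus O,\ a\in A(x)\}$ and let $\mathbb F$ be the set of measurable $f:K\setminus O\to A$ with $f(x)\in A(x)$ for all $x$. A policy $\pi=(\pi_t)_{t\in\mathbb N_0}$ is a sequence of stochastic kernels $\pi_t$ on $A$ given the histories $h_t=(x_0,a_0,\dots,x_{t-1},a_{t-1},x_t)$ with $\pi_t(A(x_t)|h_t)=1$. Under $\mathsf P^\pi_x$ (expectation $\mathsf E^\pi_x$) one has $x_0=x$, $a_t$ has conditional law $\pi_t(\cdot|h_t)$ given $h_t$, and $x_{t+1}$ has conditional law $Q(\cdot|x_t,a_t)$ given $(h_t,a_t)$.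 Let $$\tau=\inf\{t\in\mathbb N_0: x_t\in O\},\qquad \tau'=\inf\{t\in\mathbb N_0:x_t\in X\setminus K\}\qquad(\inf\emptyset=\infty),$$ and $V(\pi,x)=\mathsf P^\pi_x(\tau<\tau',\ \tau<\infty)$. The process is regarded as killed at $\tau\wedge\tau'$: an admissible policy prescribes $\pi_t$ only on $\{t<\tau\wedge\tau'\}$ (so only at states in $K\setminus O$). Nothing below depends on actions taken at times $\ge\tau\wedge\tau'$; they may be taken to be given by an arbitrary fixed feasible measurable rule. $\Pi_M$ is the class of (randomized) Markov policies: $\pi_t(\cdot|h_t)=\varphi_t(\cdot|x_t)$ with $\varphi_t$ a stochastic kernel on $A$ given $K\setminus O$ satisfying $\varphi_t(A(x)|x)=1$. For $f\in\mathbb F$, $f^\infty$ is the deterministic stationary policy that plays $a_t=f(x_t)$ for $t<\tau\wedge\tau'$. $b\mathfrak B(X)^+$ is the set of nonnegative bounded measurable functions $X\to\mathbb R$; $\bar B$ is the set of bounded functions $g$ on $X$ with $g|_{X\setminus K}=0$ and $\sup_X|g|\le1$. A set-valued map $\Psi$ is upper hemicontinuous if for every $x$ and every open neighbourhood $U$ of $\Psi(x)$ there is a neighbourhood $W$ of $x$ with $\Psi(z)\subseteq U$ for $z\in W$; it is weakly measurable if $\{x:\Psi(x)\cap G\ne\emptyset\}$ is measurable for every open $G$. Terms multiplied by $\mathbf 1_{K\setminus O}(x)$ are read as $0$ for $x\notin K\setminus O$. *)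

theory Defs
  imports "HOL-Probability.Probability"
begin

section \<open>Reach-avoid Markov decision models\<close>

text \<open>
  A Borel space is a Borel subset of a type of class \<open>polish_space\<close>; it carries the subspace
  topology and the trace of the Borel sigma-algebra.  The field \<open>dflt\<close> is the
  feasible measurable rule by which actions are chosen once the process has been killed.
\<close>

record ('x, 'a) reach_avoid =
  states :: "'x set"
  actions :: "'a set"
  feasible :: "'x \<Rightarrow> 'a set"
  kernel :: "'x \<times> 'a \<Rightarrow> 'x measure"
  target :: "'x set"
  safe :: "'x set"
  dflt :: "'x \<Rightarrow> 'a"

definition state_space :: "('x::polish_space, 'a::polish_space) reach_avoid \<Rightarrow> 'x measure" where
  "state_space M = restrict_space borel (states M)"

definition action_space :: "('x::polish_space, 'a::polish_space) reach_avoid \<Rightarrow> 'a measure" where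
  "action_space M = restrict_space borel (actions M)"

abbreviation step_space ::
    "('x::polish_space, 'a::polish_space) reach_avoid \<Rightarrow> ('x \<times> 'a) measure" where
  "step_space M \<equiv> state_space M \<Otimes>\<^sub>M action_space M"

definition feasible_pairs :: "('x, 'a) reach_avoid \<Rightarrow> ('x \<times> 'a) set" where
  "feasible_pairs M = (SIGMA x:states M. feasible M x)"

definition live :: "('x, 'a) reach_avoid \<Rightarrow> 'x set" where
  "live M = safe M - target M"

definition live_pairs :: "('x, 'a) reach_avoid \<Rightarrow> ('x \<times> 'a) set" where
  "live_pairs M = (SIGMA x:live M. feasible M x)"

text \<open>
  The last two conjuncts say that the graph of \<open>dflt\<close> is contained in the feasible pairs.
\<close>

definition reach_avoid_model :: "('x::polish_space, 'a::polish_space) reach_avoid \<Rightarrow> bool" where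
  "reach_avoid_model M \<longleftrightarrow>
     states M \<in> sets borel \<and> states M \<noteq> {} \<and>
     actions M \<in> sets borel \<and> actions M \<noteq> {} \<and>
     (\<forall>x\<in>states M. feasible M x \<noteq> {} \<and> feasible M x \<in> sets (action_space M)) \<and>
     feasible_pairs M \<in> sets (step_space M) \<and>
     kernel M \<in> restrict_space (step_space M) (feasible_pairs M) \<rightarrow>\<^sub>M prob_algebra (state_space M) \<and>
     target M \<in> sets (state_space M) \<and> safe M \<in> sets (state_space M) \<and>
     target M \<noteq> {} \<and> target M \<subset> safe M \<and>
     dflt M \<in> state_space M \<rightarrow>\<^sub>M action_space M \<and>
     (\<forall>x\<in>states M. dflt M x \<in> feasible M x)"


section \<open>Policies\<close>

text \<open>
  \<open>\<pi> t h x\<close> is the law of the action at time \<open>t\<close>, where the history is split into the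
  state-action pairs \<open>h s\<close> at times \<open>s < t\<close> and the current state \<open>x\<close>.
\<close>

type_synonym ('x, 'a) policy = "nat \<Rightarrow> (nat \<Rightarrow> 'x \<times> 'a) \<Rightarrow> 'x \<Rightarrow> 'a measure"

definition policies :: "('x::polish_space, 'a::polish_space) reach_avoid \<Rightarrow> ('x, 'a) policy set" where
  "policies M = {\<pi>. \<forall>t.
     (\<lambda>(h, x). \<pi> t h x)
       \<in> (PiM {0..<t} (\<lambda>_. step_space M)) \<Otimes>\<^sub>M state_space M \<rightarrow>\<^sub>M prob_algebra (action_space M) \<and>
     (\<forall>h \<in> space (PiM {0..<t} (\<lambda>_. step_space M)). \<forall>x \<in> states M.
        emeasure (\<pi> t h x) (feasible M x) = 1)}"

text \<open>
  The clock-dependent kernels \<open>\<phi> t\<close> are followed as long as neither the target nor the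
  cemetery has been visited; from then on \<open>dflt\<close> is used, even if the process returns to
  \<open>live M\<close>.
\<close>

definition killed_policy ::
    "('x::polish_space, 'a::polish_space) reach_avoid \<Rightarrow> (nat \<Rightarrow> 'x \<Rightarrow> 'a measure) \<Rightarrow> ('x, 'a) policy" where
  "killed_policy M \<phi> t h x =
     (if (\<forall>s<t. fst (h s) \<in> live M) \<and> x \<in> live M then \<phi> t x
      else return (action_space M) (dflt M x))"

definition markov_kernels ::
    "('x::polish_space, 'a::polish_space) reach_avoid \<Rightarrow> (nat \<Rightarrow> 'x \<Rightarrow> 'a measure) set" where
  "markov_kernels M = {\<phi>. \<forall>t.
     \<phi> t \<in> restrict_space (state_space M) (live M) \<rightarrow>\<^sub>M prob_algebra (action_space M) \<and>
     (\<forall>x\<in>live M. emeasure (\<phi> t x) (feasible M x) = 1)}"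

definition markov_policies ::
    "('x::polish_space, 'a::polish_space) reach_avoid \<Rightarrow> ('x, 'a) policy set" where
  "markov_policies M = killed_policy M ` markov_kernels M"

definition selectors :: "('x::polish_space, 'a::polish_space) reach_avoid \<Rightarrow> ('x \<Rightarrow> 'a) set" where
  "selectors M = {f. f \<in> restrict_space (state_space M) (live M) \<rightarrow>\<^sub>M action_space M \<and>
     (\<forall>x\<in>live M. f x \<in> feasible M x)}"

definition stationary ::
    "('x::polish_space, 'a::polish_space) reach_avoid \<Rightarrow> ('x \<Rightarrow> 'a) \<Rightarrow> ('x, 'a) policy" where
  "stationary M f = killed_policy M (\<lambda>t x. return (action_space M) (f x))"


section \<open>The controlled process\<close>

text \<open>
  The Ionescu-Tulcea theorem in the library wants kernels on full product spaces, so the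
  transition law is extended arbitrarily (here: the state stays put) to infeasible pairs;
  these have probability zero under every policy.
\<close>

definition next_state_law ::
    "('x::polish_space, 'a::polish_space) reach_avoid \<Rightarrow> 'x \<times> 'a \<Rightarrow> 'x measure" where
  "next_state_law M p =
     (if p \<in> feasible_pairs M then kernel M p else return (state_space M) (fst p))"

definition state_law :: "('x::polish_space, 'a::polish_space) reach_avoid \<Rightarrow> 'x \<Rightarrow> nat \<Rightarrow>
    (nat \<Rightarrow> 'x \<times> 'a) \<Rightarrow> 'x measure" where
  "state_law M x0 t h =
     (if t = 0 then return (state_space M) x0 else next_state_law M (h (t - 1)))"

definition step_law :: "('x::polish_space, 'a::polish_space) reach_avoid \<Rightarrow> ('x, 'a) policy \<Rightarrow> 'x \<Rightarrow>
    nat \<Rightarrow> (nat \<Rightarrow> 'x \<times> 'a) \<Rightarrow> ('x \<times> 'a) measure" where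
  "step_law M \<pi> x0 t h =
     state_law M x0 t h \<bind> (\<lambda>x. \<pi> t h x \<bind> (\<lambda>a. return (step_space M) (x, a)))"

text \<open>
  The law of the process started in \<open>x0\<close> on the space of sequences of state-action pairs: the
  projective limit of the family \<open>Ionescu_Tulcea.CI\<close> of finite-dimensional marginals generated
  by the conditional laws \<open>step_law\<close>.
\<close>

definition process_law :: "('x::polish_space, 'a::polish_space) reach_avoid \<Rightarrow> ('x, 'a) policy \<Rightarrow> 'x \<Rightarrow>
    (nat \<Rightarrow> 'x \<times> 'a) measure" where
  "process_law M \<pi> x0 =
     projective_family.lim UNIV
       (Ionescu_Tulcea.CI (step_law M \<pi> x0) (\<lambda>_. step_space M)) (\<lambda>_. step_space M)"

lemma space_state_space [simp]: "space (state_space M) = states M"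
  by (simp add: state_space_def space_restrict_space)

lemma space_action_space [simp]: "space (action_space M) = actions M"
  by (simp add: action_space_def space_restrict_space)

lemma markov_policies_subset_policies:
  assumes "reach_avoid_model M"
  shows "markov_policies M \<subseteq> policies M"
proof
  fix \<pi> assume "\<pi> \<in> markov_policies M"
  then obtain \<phi> where \<phi>: "\<phi> \<in> markov_kernels M" and \<pi>: "\<pi> = killed_policy M \<phi>"
    by (auto simp: markov_policies_def)
  let ?H = "\<lambda>t. PiM {0..<t} (\<lambda>_. step_space M)"
  have [measurable]: "live M \<in> sets (state_space M)" "dflt M \<in> state_space M \<rightarrow>\<^sub>M action_space M"
    using assms by (auto simp: live_def reach_avoid_model_def)
  have live_sub: "live M \<subseteq> states M"
    using assms sets.sets_into_space[of "safe M" "state_space M"]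
    by (auto simp: live_def reach_avoid_model_def)
  have feas: "feasible M x \<in> sets (action_space M)" "dflt M x \<in> feasible M x"
    if "x \<in> states M" for x
    using assms that by (auto simp: reach_avoid_model_def)
  have meas: "(\<lambda>(h, x). \<pi> t h x) \<in> ?H t \<Otimes>\<^sub>M state_space M \<rightarrow>\<^sub>M prob_algebra (action_space M)" for t
  proof -
    let ?N = "?H t \<Otimes>\<^sub>M state_space M"
    let ?P = "\<lambda>p. (\<forall>s\<in>{0..<t}. fst (fst p s) \<in> live M) \<and> snd p \<in> live M"
    have [measurable]: "(\<lambda>p. fst (fst p s)) \<in> ?N \<rightarrow>\<^sub>M state_space M" if "s \<in> {0..<t}" for s
      using that by measurable
    have P: "{p \<in> space ?N. ?P p} \<in> sets ?N"
      by measurable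
    have "(\<lambda>p. if ?P p then \<phi> t (snd p) else return (action_space M) (dflt M (snd p)))
            \<in> ?N \<rightarrow>\<^sub>M prob_algebra (action_space M)"
    proof (subst measurable_If_restrict_space_iff)
      show "{p \<in> space ?N. ?P p} \<in> sets ?N" by (rule P)
      have 1: "snd \<in> restrict_space ?N {p. ?P p} \<rightarrow>\<^sub>M restrict_space (state_space M) (live M)"
        by (rule measurable_restrict_space2)
          (auto simp: space_restrict_space intro!: measurable_restrict_space1)
      have 2: "(\<lambda>p. return (action_space M) (dflt M (snd p)))
                 \<in> restrict_space ?N {p. \<not> ?P p} \<rightarrow>\<^sub>M prob_algebra (action_space M)"
        by (rule measurable_restrict_space1, rule measurable_compose[OF measurable_snd])
          (measurable)
      show "(\<lambda>p. \<phi> t (snd p)) \<in> restrict_space ?N {p. ?P p} \<rightarrow>\<^sub>M prob_algebra (action_space M) \<and>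
            (\<lambda>p. return (action_space M) (dflt M (snd p)))
                 \<in> restrict_space ?N {p. \<not> ?P p} \<rightarrow>\<^sub>M prob_algebra (action_space M)"
        using measurable_compose[OF 1, of "\<phi> t"] \<phi> 2 by (auto simp: markov_kernels_def)
    qed
    then show ?thesis
      unfolding \<pi> killed_policy_def[abs_def] by (simp add: case_prod_beta' Ball_def)
  qed
  have "emeasure (\<pi> t h x) (feasible M x) = 1" if "x \<in> states M" for t h x
    using \<phi> feas[OF that] by (auto simp: \<pi> killed_policy_def markov_kernels_def)
  with meas show "\<pi> \<in> policies M"
    by (auto simp: policies_def)
qed

text \<open>Hence \<open>process_law\<close> is the Ionescu-Tulcea measure with one-step conditional laws \<open>step_law\<close>.\<close>

lemma Ionescu_Tulcea_step_law:
  assumes "reach_avoid_model M" "\<pi> \<in> policies M" "x0 \<in> states M"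
  shows "Ionescu_Tulcea (step_law M \<pi> x0) (\<lambda>_. step_space M)"
proof -
  let ?H = "\<lambda>t. PiM {0..<t} (\<lambda>_. step_space M)"
  have [measurable]: "feasible_pairs M \<in> sets (step_space M)"
    and k: "kernel M \<in> restrict_space (step_space M) (feasible_pairs M) \<rightarrow>\<^sub>M prob_algebra (state_space M)"
    using assms by (auto simp: reach_avoid_model_def)
  have next_m: "next_state_law M \<in> step_space M \<rightarrow>\<^sub>M prob_algebra (state_space M)"
    unfolding next_state_law_def[abs_def]
    by (subst measurable_If_restrict_space_iff)
      (auto intro!: k measurable_restrict_space1 simp: Collect_conj_eq Int_commute)
  have state_m: "state_law M x0 t \<in> ?H t \<rightarrow>\<^sub>M prob_algebra (state_space M)" for t
  proof (cases t)
    case 0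
    have "return (state_space M) x0 \<in> space (prob_algebra (state_space M))"
      using assms(3) by (auto simp: space_prob_algebra prob_space_return)
    then show ?thesis by (simp add: 0 state_law_def[abs_def])
  next
    case (Suc n)
    have "(\<lambda>h. h n) \<in> ?H t \<rightarrow>\<^sub>M step_space M"
      using Suc by (intro measurable_component_singleton) auto
    from measurable_compose[OF this next_m] show ?thesis
      by (simp add: Suc state_law_def[abs_def])
  qed
  have pol: "(\<lambda>(h, x). \<pi> t h x) \<in> ?H t \<Otimes>\<^sub>M state_space M \<rightarrow>\<^sub>M prob_algebra (action_space M)" for t
    using assms(2) by (simp add: policies_def)
  have step: "step_law M \<pi> x0 t \<in> ?H t \<rightarrow>\<^sub>M prob_algebra (step_space M)" for t
    unfolding step_law_def[abs_def]
  proof (rule measurable_bind_prob_space2[OF state_m])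
    show "(\<lambda>(h, x). \<pi> t h x \<bind> (\<lambda>a. return (step_space M) (x, a)))
            \<in> ?H t \<Otimes>\<^sub>M state_space M \<rightarrow>\<^sub>M prob_algebra (step_space M)"
      unfolding case_prod_beta'
      by (rule measurable_bind_prob_space2[OF pol[unfolded case_prod_beta']]) measurable
  qed
  show ?thesis
  proof (rule Ionescu_Tulcea.intro)
    show "step_law M \<pi> x0 t \<in> ?H t \<rightarrow>\<^sub>M subprob_algebra (step_space M)" for t
      using step by (rule measurable_prob_algebraD)
    show "h \<in> space (?H t) \<Longrightarrow> prob_space (step_law M \<pi> x0 t h)" for t h
      using measurable_space[OF step] by (simp add: space_prob_algebra)
  qed
qed

text \<open>Hitting time of a set of states, with value \<open>\<infinity>\<close> if the set is never visited.\<close>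

definition hit :: "'x set \<Rightarrow> (nat \<Rightarrow> 'x \<times> 'a) \<Rightarrow> enat" where
  "hit S \<omega> = Inf (enat ` {t. fst (\<omega> t) \<in> S})"

definition tau :: "('x, 'a) reach_avoid \<Rightarrow> (nat \<Rightarrow> 'x \<times> 'a) \<Rightarrow> enat" where
  "tau M = hit (target M)"

definition tau' :: "('x, 'a) reach_avoid \<Rightarrow> (nat \<Rightarrow> 'x \<times> 'a) \<Rightarrow> enat" where
  "tau' M = hit (states M - safe M)"

definition reach_prob ::
    "('x::polish_space, 'a::polish_space) reach_avoid \<Rightarrow> ('x, 'a) policy \<Rightarrow> 'x \<Rightarrow> real" where
  "reach_prob M \<pi> x =
     measure (process_law M \<pi> x)
       {\<omega> \<in> space (process_law M \<pi> x). tau M \<omega> < tau' M \<omega> \<and> tau M \<omega> < \<infinity>}"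

definition opt_value :: "('x::polish_space, 'a::polish_space) reach_avoid \<Rightarrow> 'x \<Rightarrow> real" where
  "opt_value M x = (SUP \<pi>\<in>markov_policies M. reach_prob M \<pi> x)"

definition optimal :: "('x::polish_space, 'a::polish_space) reach_avoid \<Rightarrow> ('x, 'a) policy \<Rightarrow> bool" where
  "optimal M \<pi> \<longleftrightarrow> (\<forall>x\<in>states M. reach_prob M \<pi> x = opt_value M x)"


section \<open>Function classes and the Bellman equation\<close>

text \<open>Functions on the state space are total functions whose values off \<open>states M\<close> are ignored.\<close>

definition bdd_meas :: "('x::polish_space, 'a::polish_space) reach_avoid \<Rightarrow> ('x \<Rightarrow> real) set" where
  "bdd_meas M = {g \<in> borel_measurable (state_space M). bounded (g ` states M)}"

definition bdd_meas_nonneg :: "('x::polish_space, 'a::polish_space) reach_avoid \<Rightarrow> ('x \<Rightarrow> real) set" where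
  "bdd_meas_nonneg M = {g \<in> bdd_meas M. \<forall>x\<in>states M. 0 \<le> g x}"

definition B_bar :: "('x, 'a) reach_avoid \<Rightarrow> ('x \<Rightarrow> real) set" where
  "B_bar M = {g. bounded (g ` states M) \<and> (\<forall>x \<in> states M - safe M. g x = 0) \<and>
     (SUP x\<in>states M. \<bar>g x\<bar>) \<le> 1}"

definition bellman_int :: "('x, 'a) reach_avoid \<Rightarrow> ('x \<Rightarrow> real) \<Rightarrow> 'x \<Rightarrow> 'a \<Rightarrow> real" where
  "bellman_int M \<psi> x a = (\<integral>y. indicator (safe M) y * \<psi> y \<partial>kernel M (x, a))"

definition attains_max :: "('x, 'a) reach_avoid \<Rightarrow> ('x \<Rightarrow> real) \<Rightarrow> 'x \<Rightarrow> 'a \<Rightarrow> bool" where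
  "attains_max M \<psi> x a \<longleftrightarrow>
     a \<in> feasible M x \<and> (\<forall>b\<in>feasible M x. bellman_int M \<psi> x b \<le> bellman_int M \<psi> x a)"

text \<open>
  The maximum is the supremum together with the requirement that it is attained.  For
  \<open>x \<notin> live M\<close> the second summand vanishes, whatever the value of the supremum.
\<close>

definition bellman_solution :: "('x, 'a) reach_avoid \<Rightarrow> ('x \<Rightarrow> real) \<Rightarrow> bool" where
  "bellman_solution M \<psi> \<longleftrightarrow>
     (\<forall>x\<in>live M. \<exists>a. attains_max M \<psi> x a) \<and>
     (\<forall>x\<in>states M. \<psi> x = indicator (target M) x +
        indicator (live M) x * (SUP a\<in>feasible M x. bellman_int M \<psi> x a))"

definition selector_equation :: "('x, 'a) reach_avoid \<Rightarrow> ('x \<Rightarrow> 'a) \<Rightarrow> ('x \<Rightarrow> real) \<Rightarrow> bool" where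
  "selector_equation M f V \<longleftrightarrow> (\<forall>x\<in>states M. V x =
     (if x \<in> target M then 1
      else if x \<in> live M then (LINT y:safe M|kernel M (x, f x). V y)
      else 0))"


section \<open>Regularity assumptions\<close>

definition upper_hemicontinuous ::
    "'x::topological_space set \<Rightarrow> 'a::topological_space set \<Rightarrow> ('x \<Rightarrow> 'a set) \<Rightarrow> bool" where
  "upper_hemicontinuous S T \<Psi> \<longleftrightarrow>
     (\<forall>x\<in>S. \<forall>U. openin (top_of_set T) U \<and> \<Psi> x \<subseteq> U \<longrightarrow>
        (\<exists>W. openin (top_of_set S) W \<and> x \<in> W \<and> (\<forall>z\<in>W. \<Psi> z \<subseteq> U)))"

definition weakly_measurable ::
    "'x::topological_space set \<Rightarrow> 'a::topological_space set \<Rightarrow> ('x \<Rightarrow> 'a set) \<Rightarrow> bool" where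
  "weakly_measurable S T \<Psi> \<longleftrightarrow>
     (\<forall>G. openin (top_of_set T) G \<longrightarrow> {x\<in>S. \<Psi> x \<inter> G \<noteq> {}} \<in> sets (restrict_space borel S))"

definition strongly_Feller :: "('x::polish_space, 'a::polish_space) reach_avoid \<Rightarrow> bool" where
  "strongly_Feller M \<longleftrightarrow> (\<forall>g \<in> bdd_meas M.
     continuous_on (live_pairs M) (\<lambda>p. \<integral>y. g y \<partial>kernel M p) \<and>
     bounded ((\<lambda>p. \<integral>y. g y \<partial>kernel M p) ` live_pairs M))"

end

theory Submission
  imports Defs
begin

text \<open>
  Value iteration from \<open>0\<close> increases to a measurable fixed point \<open>W\<close> of the Bellman operator: the
  supremum over actions commutes with the increasing limit, and by strong Feller continuity and
  upper hemicontinuity every iterate has a measurable maximizer.  For a nonnegative solution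
  \<open>\<psi>\<close> the expectation of \<open>\<psi>\<close> at time \<open>k\<close> on the event that the process has not been killed before
  \<open>k\<close> loses, from \<open>k\<close> to \<open>k + 1\<close>, at least the probability of reaching the target at time \<open>k\<close>;
  summing over \<open>k\<close> gives \<open>V(\<pi>, x) \<le> \<psi>(x)\<close> for all Markov policies.  Under a selector that maximizes
  for \<open>W\<close> the loss is exactly that probability and the remainder vanishes because the process is
  killed almost surely, so \<open>W\<close> is attained and equals the optimal value.  If \<open>f\<close> is optimal,
  the same summation started at time \<open>1\<close> bounds \<open>W(x) = V(f, x)\<close> by the right-hand side of the
  selector equation.
\<close>

section \<open>Measurable maximizers\<close>

text \<open>Nested approximation in the style of Kuratowski and Ryll-Nardzewski: \<open>F x\<close>
  is cut down by closed balls of radii \<open>(1/2) ^ n\<close> around a dense sequence. Compactness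
  keeps the intersection of the stages nonempty, the shrinking radii reduce it to one point, and
  this point depends measurably on \<open>x\<close> because it lies in a closed set iff every stage
  meets that set.\<close>

lemma compact_valued_selector:
  fixes F :: "'x \<Rightarrow> 'a::{metric_space, second_countable_topology} set"
  assumes compact: "\<And>x. x \<in> space N \<Longrightarrow> compact (F x)"
    and nonempty: "\<And>x. x \<in> space N \<Longrightarrow> F x \<noteq> {}"
    and hit: "\<And>C. closed C \<Longrightarrow> {x \<in> space N. F x \<inter> C \<noteq> {}} \<in> sets N"
  obtains f where "f \<in> borel_measurable N" "\<And>x. x \<in> space N \<Longrightarrow> f x \<in> F x"
proof -
  obtain D :: "'a set" where D: "countable D" "\<And>X. open X \<Longrightarrow> X \<noteq> {} \<Longrightarrow> \<exists>d\<in>D. d \<in> X"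
    using countable_dense_setE by blast
  define d where "d = from_nat_into D"
  have "D \<noteq> {}" using D(2)[of UNIV] by auto
  have d: "\<exists>i. dist (d i) y \<le> r" if "r > 0" for y r
  proof -
    have "ball y r \<noteq> {}" using that by simp
    then obtain z where "z \<in> D" "z \<in> ball y r"
      using D(2)[of "ball y r"] by blast
    moreover obtain i where "d i = z"
      using from_nat_into_surj[OF D(1) \<open>z \<in> D\<close>] by (auto simp: d_def)
    ultimately show ?thesis by (auto simp: dist_commute intro!: exI[of _ i])
  qed
  define r where "r n = (1/2::real) ^ n" for n :: nat
  have r: "r n > 0" for n by (simp add: r_def)
  \<comment> \<open>Cutting down with the first ball of radius \<open>(1/2) ^ n\<close> that still hits keeps hitting sets measurable.\<close>
  define idx where "idx n H x = (LEAST i. H x \<inter> cball (d i) (r n) \<noteq> {})" for n and H :: "'x \<Rightarrow> 'a set" and x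
  define G where "G = rec_nat F (\<lambda>n H x. H x \<inter> cball (d (idx n H x)) (r n))"
  have G0: "G 0 = F" by (simp add: G_def)
  have GS: "G (Suc n) x = G n x \<inter> cball (d (idx n (G n) x)) (r n)" for n x
    by (simp add: G_def)
  have G: "compact (G n x) \<and> G n x \<noteq> {}" if "x \<in> space N" for n x
  proof (induction n)
    case (Suc n)
    then obtain y where y: "y \<in> G n x" by auto
    obtain i where "dist (d i) y \<le> r n" using d[OF r] by blast
    with y have "G n x \<inter> cball (d i) (r n) \<noteq> {}" by force
    then have "G n x \<inter> cball (d (idx n (G n) x)) (r n) \<noteq> {}"
      unfolding idx_def by (rule LeastI)
    moreover have "compact (G n x \<inter> cball (d (idx n (G n) x)) (r n))"
      using Suc by (intro compact_Int_closed) auto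
    ultimately have "compact (G n x \<inter> cball (d (idx n (G n) x)) (r n)) \<and> G n x \<inter> cball (d (idx n (G n) x)) (r n) \<noteq> {}" by (intro conjI)
    then show ?case by (subst (1 2) GS)
  next
    case 0
    show ?case unfolding G0 using compact[OF that] nonempty[OF that] by blast
  qed
  have Gm: "{x \<in> space N. G n x \<inter> C \<noteq> {}} \<in> sets N" if "closed C" for n C
    using that
  proof (induction n arbitrary: C)
    case (Suc n)
    have [measurable]: "Measurable.pred N (\<lambda>x. G n x \<inter> cball (d i) (r n) \<noteq> {})" for i
      using Suc.IH[of "cball (d i) (r n)"] by (simp add: pred_def)
    have [measurable]: "idx n (G n) \<in> N \<rightarrow>\<^sub>M count_space UNIV"
      unfolding idx_def by measurable
    have [measurable]: "Measurable.pred N (\<lambda>x. G n x \<inter> (cball (d i) (r n) \<inter> C) \<noteq> {})" for i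
      using Suc.IH[of "cball (d i) (r n) \<inter> C"] Suc.prems by (simp add: pred_def closed_Int)
    have "{x \<in> space N. G (Suc n) x \<inter> C \<noteq> {}} =
      {x \<in> space N. \<exists>i. idx n (G n) x = i \<and> G n x \<inter> (cball (d i) (r n) \<inter> C) \<noteq> {}}"
      by (auto simp: GS Int_assoc)
    also have "\<dots> \<in> sets N" by measurable
    finally show ?case .
  next
    case 0
    then show ?case unfolding G0 by (rule hit)
  qed
  have dec: "G n x \<subseteq> G m x" if "m \<le> n" for m n x
    using that by (induction rule: dec_induct) (auto simp: GS)
  have small: "dist y z \<le> 2 * r n" if "y \<in> G (Suc n) x" "z \<in> G (Suc n) x" for n x y z
    using that dist_triangle3[of y z "d (idx n (G n) x)"] by (auto simp: GS)
  \<comment> \<open>The finite intersection property along the decreasing stages, relative to a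
    closed \<open>C\<close>: \<open>C = UNIV\<close> produces the selected point, the complement of
    an open set its measurability.\<close>
  have nest: "\<exists>y. \<forall>n. y \<in> G n x \<inter> C"
    if "x \<in> space N" "closed C" "\<And>n. G n x \<inter> C \<noteq> {}" for x C
  proof -
    have cl: "compact (G n x \<inter> C)" for n
      using that G[of x n] by (intro compact_Int_closed) auto
    have "(G 0 x \<inter> C) \<inter> (\<Inter>n\<in>UNIV. G n x \<inter> C) \<noteq> {}"
    proof (rule compact_imp_fip_image[of "G 0 x \<inter> C" UNIV "\<lambda>n. G n x \<inter> C"])
      show "compact (G 0 x \<inter> C)" by (rule cl)
      show "closed (G n x \<inter> C)" for n by (rule compact_imp_closed[OF cl])
    next
      fix I :: "nat set" assume "finite I"
      then obtain k where "\<And>i. i \<in> I \<Longrightarrow> i \<le> k"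
        unfolding finite_nat_set_iff_bounded_le by blast
      then have "G k x \<inter> C \<subseteq> (G 0 x \<inter> C) \<inter> (\<Inter>n\<in>I. G n x \<inter> C)"
        using dec[of _ k x] by blast
      with that(3)[of k] show "(G 0 x \<inter> C) \<inter> (\<Inter>n\<in>I. G n x \<inter> C) \<noteq> {}" by blast
    qed
    then show ?thesis by blast
  qed
  define f where "f x = (SOME y. \<forall>n. y \<in> G n x)" for x
  have f: "f x \<in> G n x" if "x \<in> space N" for n x
    using someI_ex[of "\<lambda>y. \<forall>n. y \<in> G n x"] nest[of x UNIV] that G unfolding f_def by auto
  \<comment> \<open>Two points common to all stages are within \<open>2 * r n\<close> of each other
    for every \<open>n\<close>; hence a witness found inside a closed set must be
    \<open>f x\<close>.\<close>
  have uniq: "y = f x" if "x \<in> space N" "\<And>n. y \<in> G n x" for x y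
  proof -
    have "(\<lambda>n. 2 * r n) \<longlonglongrightarrow> 2 * 0"
      unfolding r_def by (intro tendsto_intros LIMSEQ_realpow_zero) auto
    moreover have "dist y (f x) \<le> 2 * r n" for n
      using small[OF that(2) f[OF that(1)]] .
    ultimately have "dist y (f x) \<le> 2 * 0"
      by (intro LIMSEQ_le_const) blast+
    then show ?thesis by simp
  qed
  have "f \<in> borel_measurable N"
  proof (rule borel_measurableI)
    fix S :: "'a set" assume "open S"
    have iff: "f x \<in> -S \<longleftrightarrow> (\<forall>n. G n x \<inter> -S \<noteq> {})" if "x \<in> space N" for x
    proof
      assume "\<forall>n. G n x \<inter> -S \<noteq> {}"
      with nest[OF that, of "-S"] \<open>open S\<close> obtain y where "\<forall>n. y \<in> G n x \<inter> -S"
        by auto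
      with uniq[OF that, of y] show "f x \<in> -S" by auto
    qed (use f[OF that] in auto)
    have "f -` S \<inter> space N = space N - (\<Inter>n. {x \<in> space N. G n x \<inter> -S \<noteq> {}})"
      using iff by auto
    also have "\<dots> \<in> sets N"
      using Gm[of "-S"] \<open>open S\<close> by (intro sets.Diff sets.top sets.countable_INT') auto
    finally show "f -` S \<inter> space N \<in> sets N" .
  qed
  then show thesis
    using f[of _ 0] by (auto simp: G0 intro: that)
qed

text \<open>A tube argument. A point \<open>x0\<close> outside the set has a compact fibre over it
  that is disjoint from the closed superlevel set of \<open>q\<close>, so a whole product
  neighbourhood of the fibre is disjoint from it, and upper hemicontinuity keeps the nearby fibres
  inside that neighbourhood. With \<open>C = UNIV\<close> this concerns the maximum of
  \<open>q\<close>; a general closed \<open>C\<close> serves the hitting sets of the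
  maximizers.\<close>

lemma closedin_superlevel_uhc:
  fixes q :: "'x::topological_space \<times> 'a::topological_space \<Rightarrow> real"
  assumes uhc: "upper_hemicontinuous S T \<Psi>"
    and compact: "\<And>x. x \<in> S \<Longrightarrow> compact (\<Psi> x)"
    and sub: "\<And>x. x \<in> S \<Longrightarrow> \<Psi> x \<subseteq> T"
    and cont: "continuous_on (SIGMA x:S. \<Psi> x) q"
    and C: "closed C"
  shows "closedin (top_of_set S) {x \<in> S. \<exists>a\<in>\<Psi> x \<inter> C. r \<le> q (x, a)}" (is "closedin _ ?L")
proof -
  let ?Gr = "SIGMA x:S. \<Psi> x"
  have "closedin (top_of_set ?Gr) (?Gr \<inter> q -` {r..} \<inter> (?Gr \<inter> (UNIV \<times> C)))"
    using cont C by (intro closedin_Int continuous_closedin_preimage closedin_closed_Int closed_Times) auto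
  \<comment> \<open>The superlevel set is closed only relative to the graph; the tube lemma needs
    \<open>D\<close>, which is closed in the full product.\<close>
  then obtain D where D: "closed D" "?Gr \<inter> q -` {r..} \<inter> (?Gr \<inter> (UNIV \<times> C)) = ?Gr \<inter> D"
    by (auto simp: closedin_closed)
  have L: "x \<in> ?L \<longleftrightarrow> x \<in> S \<and> (\<exists>a\<in>\<Psi> x. (x, a) \<in> D)" for x
  proof -
    have "a \<in> \<Psi> x \<Longrightarrow> x \<in> S \<Longrightarrow> (x, a) \<in> D \<longleftrightarrow> a \<in> C \<and> r \<le> q (x, a)" for a
      using eqset_imp_iff[OF D(2), of "(x, a)"] by auto
    then show ?thesis by auto
  qed
  have "\<exists>W. openin (top_of_set S) W \<and> x0 \<in> W \<and> W \<subseteq> S - ?L" if x0: "x0 \<in> S - ?L" for x0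
  proof -
    have "{x0} \<times> \<Psi> x0 \<subseteq> - D" using x0 L by auto
    then obtain U V where UV: "open U" "open V" "x0 \<in> U" "\<Psi> x0 \<subseteq> V" "U \<times> V \<subseteq> - D"
      using tube_lemma_right[of euclidean euclidean "- D" "\<Psi> x0" x0] D(1) compact[of x0] x0
      by (auto simp: open_Compl)
    have "openin (top_of_set T) (T \<inter> V)" using UV by (auto intro: openin_open_Int)
    moreover have "\<Psi> x0 \<subseteq> T \<inter> V" using x0 sub UV by auto
    ultimately obtain W where W: "openin (top_of_set S) W" "x0 \<in> W" "\<And>z. z \<in> W \<Longrightarrow> \<Psi> z \<subseteq> T \<inter> V"
      using uhc[unfolded upper_hemicontinuous_def, rule_format, of x0 "T \<inter> V"] x0 by blast
    have "x \<in> S - ?L" if x: "x \<in> W \<inter> U" for x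
    proof -
      have "(x, a) \<notin> D" if "a \<in> \<Psi> x" for a
        using UV(5) W(3)[of x] x that by auto
      then show ?thesis
        using x W(1)[THEN openin_imp_subset] L[of x] by blast
    qed
    with W UV show ?thesis
      by (intro exI[of _ "W \<inter> U"]) (auto intro: openin_Int_open)
  qed
  then have "openin (top_of_set S) (S - ?L)"
    by (subst openin_subopen) auto
  then show ?thesis
    by (auto simp: closedin_def)
qed

text \<open>The measurable maximum theorem. The maximal value has closed superlevel sets; the
  maximizers at \<open>x\<close> form a compact set \<open>F x\<close>, which meets a closed
  \<open>C\<close> exactly when the maximum over \<open>\<Psi> x \<inter> C\<close> is as large as
  the one over \<open>\<Psi> x\<close>. Hence \<open>compact_valued_selector\<close> applies to
  \<open>F\<close>.\<close>

lemma maximum_selector: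
  fixes q :: "'x::topological_space \<times> 'a::{metric_space, second_countable_topology} \<Rightarrow> real"
  assumes uhc: "upper_hemicontinuous S T \<Psi>"
    and compact: "\<And>x. x \<in> S \<Longrightarrow> compact (\<Psi> x)"
    and nonempty: "\<And>x. x \<in> S \<Longrightarrow> \<Psi> x \<noteq> {}"
    and sub: "\<And>x. x \<in> S \<Longrightarrow> \<Psi> x \<subseteq> T"
    and cont: "continuous_on (SIGMA x:S. \<Psi> x) q"
  obtains f where "f \<in> borel_measurable (restrict_space borel S)"
    "\<And>x. x \<in> S \<Longrightarrow> f x \<in> \<Psi> x" "\<And>x a. x \<in> S \<Longrightarrow> a \<in> \<Psi> x \<Longrightarrow> q (x, a) \<le> q (x, f x)"
    "(\<lambda>x. q (x, f x)) \<in> borel_measurable (restrict_space borel S)"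
proof -
  let ?N = "restrict_space borel S"
  have space: "space ?N = S" by (simp add: space_restrict_space)
  have clo: "A \<in> sets ?N" if "closedin (top_of_set S) A" for A
  proof -
    obtain C where "closed C" "A = S \<inter> C" using \<open>closedin _ A\<close> unfolding closedin_closed by blast
    then show ?thesis unfolding sets_restrict_space by (intro image_eqI[of _ _ C] borel_closed)
  qed
  note cl = clo[OF closedin_superlevel_uhc[OF uhc compact sub cont]]
  have contx: "continuous_on (\<Psi> x) (\<lambda>a. q (x, a))" if "x \<in> S" for x
    by (rule continuous_on_compose2[OF cont continuous_on_Pair[OF continuous_on_const continuous_on_id]])
      (use that in blast)
  have "\<exists>a\<in>\<Psi> x. \<forall>b\<in>\<Psi> x. q (x, b) \<le> q (x, a)" if "x \<in> S" for x
    using continuous_attains_sup[OF compact[OF that] nonempty[OF that] contx[OF that]] .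
  \<comment> \<open>\<open>g\<close> chooses maximizers without any measurability; the measurability
    claims concern only the maximal value \<open>q (x, g x)\<close>.\<close>
  then obtain g where g: "\<And>x. x \<in> S \<Longrightarrow> g x \<in> \<Psi> x" "\<And>x b. x \<in> S \<Longrightarrow> b \<in> \<Psi> x \<Longrightarrow> q (x, b) \<le> q (x, g x)"
    by metis
  have m[measurable]: "(\<lambda>x. q (x, g x)) \<in> borel_measurable ?N"
  proof (subst borel_measurable_iff_ge, intro allI)
    fix r
    have "{x \<in> space ?N. r \<le> q (x, g x)} = {x \<in> S. \<exists>a\<in>\<Psi> x \<inter> UNIV. r \<le> q (x, a)}"
      using g space by (auto intro: order_trans)
    also have "\<dots> \<in> sets ?N" by (rule cl) auto
    finally show "{x \<in> space ?N. r \<le> q (x, g x)} \<in> sets ?N" .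
  qed
  define F where "F x = {a \<in> \<Psi> x. q (x, g x) \<le> q (x, a)}" for x
  have "\<exists>f. f \<in> borel_measurable ?N \<and> (\<forall>x \<in> space ?N. f x \<in> F x)"
  proof (rule compact_valued_selector[of ?N F])
    fix x assume "x \<in> space ?N"
    then have x: "x \<in> S" using space by simp
    have "closedin (top_of_set (\<Psi> x)) (\<Psi> x \<inter> (\<lambda>a. q (x, a)) -` {q (x, g x)..})"
      using contx[OF x] by (intro continuous_closedin_preimage) auto
    moreover have "\<Psi> x \<inter> (\<lambda>a. q (x, a)) -` {q (x, g x)..} = F x" by (auto simp: F_def)
    ultimately show "compact (F x)"
      using closedin_compact[OF compact[OF x]] by simp
    show "F x \<noteq> {}" using g x by (auto simp: F_def)
  next
    fix C :: "'a set" assume C: "closed C"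
    \<comment> \<open>Quantifying over rational levels turns the comparison of two maxima into countably many superlevel sets.\<close>
    have F_iff: "F x \<inter> C \<noteq> {} \<longleftrightarrow> (\<forall>r\<in>\<rat>. r \<le> q (x, g x) \<longrightarrow> (\<exists>a\<in>\<Psi> x \<inter> C. r \<le> q (x, a)))"
      (is "_ \<longleftrightarrow> ?R") if x: "x \<in> S" for x
    proof
      assume ?R
      \<comment> \<open>Any rational level below the maximum yields a point of
        \<open>\<Psi> x \<inter> C\<close>, so that a maximum over this compact set exists.\<close>
      obtain r0 where "r0 \<in> \<rat>" "r0 < q (x, g x)"
        using Rats_dense_in_real[of "q (x, g x) - 1" "q (x, g x)"] by auto
      with \<open>?R\<close> have ne: "\<Psi> x \<inter> C \<noteq> {}" by (auto dest!: bspec[of _ _ r0])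
      have "compact (\<Psi> x \<inter> C)" using compact[OF x] C by (rule compact_Int_closed)
      then obtain a where a: "a \<in> \<Psi> x \<inter> C" "\<And>b. b \<in> \<Psi> x \<inter> C \<Longrightarrow> q (x, b) \<le> q (x, a)"
        using continuous_attains_sup[OF _ ne, of "\<lambda>a. q (x, a)"] contx[OF x]
        by (metis continuous_on_subset inf_le1)
      have "q (x, g x) \<le> q (x, a)"
      proof (rule ccontr)
        assume "\<not> ?thesis"
        then obtain r where r: "r \<in> \<rat>" "q (x, a) < r" "r < q (x, g x)"
          using Rats_dense_in_real[of "q (x, a)" "q (x, g x)"] by auto
        with \<open>?R\<close> obtain b where "b \<in> \<Psi> x \<inter> C" "r \<le> q (x, b)" by force
        with a r show False by force
      qed
      with a show "F x \<inter> C \<noteq> {}" by (auto simp: F_def)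
    qed (use order_trans in \<open>fastforce simp: F_def\<close>)
    have "{x \<in> space ?N. F x \<inter> C \<noteq> {}} =
      {x \<in> space ?N. \<forall>r\<in>\<rat>. r \<le> q (x, g x) \<longrightarrow> x \<in> {x \<in> S. \<exists>a\<in>\<Psi> x \<inter> C. r \<le> q (x, a)}}"
      unfolding space using F_iff by (intro Collect_cong conj_cong refl) simp
    also have "\<dots> \<in> sets ?N"
    proof -
      have [measurable]: "{x \<in> S. \<exists>a\<in>\<Psi> x \<inter> C. r \<le> q (x, a)} \<in> sets ?N" for r
        by (rule cl) (use C in auto)
      show ?thesis using countable_rat by measurable
    qed
    finally show "{x \<in> space ?N. F x \<inter> C \<noteq> {}} \<in> sets ?N" .
  qed blast
  then obtain f where f: "f \<in> borel_measurable ?N" "\<And>x. x \<in> space ?N \<Longrightarrow> f x \<in> F x"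
    by blast
  have eq: "q (x, f x) = q (x, g x)" if "x \<in> S" for x
    using f(2)[of x] g[of x] that space by (auto simp: F_def intro: antisym)
  show thesis
  proof (rule that[OF f(1)])
    show "f x \<in> \<Psi> x" if "x \<in> S" for x
      using f(2)[of x] that space by (simp add: F_def)
    show "q (x, a) \<le> q (x, f x)" if "x \<in> S" "a \<in> \<Psi> x" for x a
      using g(2)[OF that] eq that by simp
    show "(\<lambda>x. q (x, f x)) \<in> borel_measurable ?N"
      using m eq space by (subst measurable_cong[where g="\<lambda>x. q (x, g x)"]) auto
  qed
qed

section \<open>The process killed outside the live states\<close>

lemma (in Ionescu_Tulcea) distr_lim_C:
  "distr PF.lim (PiM {0..<n} M) (\<lambda>\<omega>. restrict \<omega> {0..<n}) = C 0 n (\<lambda>_. undefined)"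
proof -
  \<comment> \<open>\<open>CI J\<close> is a marginal of some \<open>C 0 n\<close>; on the full
    initial segment \<open>{0..<n}\<close> the embedding of cylinders is the identity.\<close>
  have "CI {0..<n} = C 0 n (\<lambda>_. undefined)"
  proof (rule measure_eqI)
    show "sets (CI {0..<n}) = sets (C 0 n (\<lambda>_. undefined))"
      by (simp add: CI_def sets_C)
    fix X assume "X \<in> sets (CI {0..<n})"
    then have "X \<in> sets (PiM {0..<n} M)" by (simp add: CI_def)
    then show "emeasure (CI {0..<n}) X = emeasure (C 0 n (\<lambda>_. undefined)) X"
      using sets.sets_into_space[of X "PiM {0..<n} M"]
      by (subst emeasure_CI[of _ n]) (auto simp: space_PiM prod_emb_id)
  qed
  then show ?thesis by (simp add: distr_lim)
qed

text \<open>\<open>C 0 (Suc n)\<close> is by construction \<open>C 0 n\<close> followed by the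
  kernel \<open>eP n\<close>, which appends one coordinate drawn from \<open>P n\<close>.
  Transferred to the infinite product, this makes \<open>P n\<close> the conditional law of
  coordinate \<open>n\<close> given the earlier ones.\<close>

lemma (in Ionescu_Tulcea) nn_integral_lim_step:
  assumes f: "f \<in> borel_measurable (PiM {0..<Suc n} M)"
  shows "(\<integral>\<^sup>+\<omega>. f (restrict \<omega> {0..<Suc n}) \<partial>PF.lim) =
    (\<integral>\<^sup>+\<omega>. (\<integral>\<^sup>+y. f ((restrict \<omega> {0..<n})(n := y)) \<partial>P n (restrict \<omega> {0..<n})) \<partial>PF.lim)"
proof -
  have r: "(\<lambda>\<omega>. restrict \<omega> {0..<k}) \<in> PF.lim \<rightarrow>\<^sub>M PiM {0..<k} M" for k
    by (subst measurable_cong_sets[OF PF.sets_lim refl]) (auto intro!: measurable_restrict_subset)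
  have m: "(\<lambda>h. \<integral>\<^sup>+x. f x \<partial>eP n h) \<in> borel_measurable (PiM {0..<n} M)"
    by (intro measurable_compose[OF measurable_eP] nn_integral_measurable_subprob_algebra f)
  have "(\<integral>\<^sup>+\<omega>. f (restrict \<omega> {0..<Suc n}) \<partial>PF.lim) = (\<integral>\<^sup>+h. f h \<partial>C 0 (Suc n) (\<lambda>_. undefined))"
    unfolding distr_lim_C[symmetric] using f by (intro nn_integral_distr[symmetric] r) auto
  also have "\<dots> = (\<integral>\<^sup>+h. (\<integral>\<^sup>+x. f x \<partial>eP n h) \<partial>C 0 n (\<lambda>_. undefined))"
  proof -
    have "eP n \<in> C 0 n (\<lambda>_. undefined) \<rightarrow>\<^sub>M subprob_algebra (PiM {0..<Suc n} M)"
      by (subst measurable_cong_sets[OF sets_C refl]) auto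
    then show ?thesis using f by (simp add: nn_integral_bind)
  qed
  also have "\<dots> = (\<integral>\<^sup>+\<omega>. (\<integral>\<^sup>+x. f x \<partial>eP n (restrict \<omega> {0..<n})) \<partial>PF.lim)"
    unfolding distr_lim_C[symmetric] using m by (intro nn_integral_distr r) auto
  also have "\<dots> = (\<integral>\<^sup>+\<omega>. (\<integral>\<^sup>+y. f ((restrict \<omega> {0..<n})(n := y)) \<partial>P n (restrict \<omega> {0..<n})) \<partial>PF.lim)"
    using measurable_space[OF r] f by (intro nn_integral_cong nn_integral_eP) auto
  finally show ?thesis .
qed

text \<open>Values are extended nonnegative, so no integrability has to be tracked, and
  \<open>next_state_law\<close> makes the function measurable on all of
  \<open>step_space M\<close>.\<close>

definition next_value :: "('x::polish_space, 'a::polish_space) reach_avoid \<Rightarrow> ('x \<Rightarrow> ennreal) \<Rightarrow> 'x \<times> 'a \<Rightarrow> ennreal" where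
  "next_value M W p = (\<integral>\<^sup>+y. W y \<partial>next_state_law M p)"

text \<open>The value \<open>0\<close> off \<open>live M\<close> encodes the killing: a run that has
  reached the target or the cemetery contributes nothing at later times.\<close>

definition kernel_value :: "('x::polish_space, 'a::polish_space) reach_avoid \<Rightarrow> ('x \<Rightarrow> 'a measure) \<Rightarrow>
    ('x \<Rightarrow> ennreal) \<Rightarrow> 'x \<Rightarrow> ennreal" where
  "kernel_value M \<kappa> W x = (if x \<in> live M then \<integral>\<^sup>+a. next_value M W (x, a) \<partial>\<kappa> x else 0)"

text \<open>The bound \<open>s < k\<close> is strict, so the state at time \<open>k\<close> itself
  is free; this lets a first visit to the target at time \<open>k\<close> be counted.\<close>

definition alive :: "('x, 'a) reach_avoid \<Rightarrow> nat \<Rightarrow> (nat \<Rightarrow> 'x \<times> 'a) \<Rightarrow> bool" where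
  "alive M k \<omega> \<longleftrightarrow> (\<forall>s<k. fst (\<omega> s) \<in> live M)"

lemma live_in_sets: "reach_avoid_model M \<Longrightarrow> live M \<in> sets (state_space M)"
  by (auto simp: live_def reach_avoid_model_def)

lemma live_subset_states: "reach_avoid_model M \<Longrightarrow> live M \<subseteq> states M"
  using sets.sets_into_space[OF live_in_sets, of M] by simp

lemma measurable_next_state_law:
  assumes "reach_avoid_model M"
  shows "next_state_law M \<in> step_space M \<rightarrow>\<^sub>M prob_algebra (state_space M)"
proof -
  have [measurable]: "feasible_pairs M \<in> sets (step_space M)"
    and k: "kernel M \<in> restrict_space (step_space M) (feasible_pairs M) \<rightarrow>\<^sub>M prob_algebra (state_space M)"
    using assms by (auto simp: reach_avoid_model_def)
  show ?thesis
    unfolding next_state_law_def[abs_def]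
    by (subst measurable_If_restrict_space_iff)
      (auto intro!: k measurable_restrict_space1 simp: Collect_conj_eq Int_commute)
qed

lemma measurable_next_value:
  assumes "reach_avoid_model M" "W \<in> borel_measurable (state_space M)"
  shows "next_value M W \<in> borel_measurable (step_space M)"
  unfolding next_value_def[abs_def]
  by (intro measurable_compose[OF measurable_prob_algebraD[OF measurable_next_state_law]]
      nn_integral_measurable_subprob_algebra assms)

lemma measurable_state_law:
  assumes "reach_avoid_model M" "x0 \<in> states M"
  shows "state_law M x0 t \<in> PiM {0..<t} (\<lambda>_. step_space M) \<rightarrow>\<^sub>M prob_algebra (state_space M)"
proof (cases t)
  case 0
  have "return (state_space M) x0 \<in> space (prob_algebra (state_space M))"
    using assms by (auto simp: space_prob_algebra prob_space_return)
  then show ?thesis by (simp add: 0 state_law_def[abs_def])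
next
  case (Suc n)
  have "(\<lambda>h. h n) \<in> PiM {0..<t} (\<lambda>_. step_space M) \<rightarrow>\<^sub>M step_space M"
    using Suc by (intro measurable_component_singleton) auto
  from measurable_compose[OF this measurable_next_state_law] assms show ?thesis
    by (simp add: Suc state_law_def[abs_def])
qed

lemma nn_integral_step_law:
  assumes "reach_avoid_model M" "\<pi> \<in> policies M" "x0 \<in> states M"
    and h: "h \<in> space (PiM {0..<t} (\<lambda>_. step_space M))"
    and g: "g \<in> borel_measurable (step_space M)"
  shows "(\<integral>\<^sup>+p. g p \<partial>step_law M \<pi> x0 t h) =
    (\<integral>\<^sup>+x. (\<integral>\<^sup>+a. g (x, a) \<partial>\<pi> t h x) \<partial>state_law M x0 t h)"
proof -
  have pol: "(\<lambda>(h, x). \<pi> t h x) \<in> (PiM {0..<t} (\<lambda>_. step_space M)) \<Otimes>\<^sub>M state_space M \<rightarrow>\<^sub>M prob_algebra (action_space M)"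
    using assms(2) by (simp add: policies_def)
  have polh: "\<pi> t h \<in> state_space M \<rightarrow>\<^sub>M prob_algebra (action_space M)"
    using measurable_compose[OF measurable_Pair1'[OF h] pol] by simp
  have s: "state_law M x0 t h \<in> space (prob_algebra (state_space M))"
    using measurable_space[OF measurable_state_law h] assms by auto
  then have ss: "sets (state_law M x0 t h) = sets (state_space M)" by (simp add: space_prob_algebra)
  have b: "(\<lambda>x. \<pi> t h x \<bind> (\<lambda>a. return (step_space M) (x, a))) \<in> state_space M \<rightarrow>\<^sub>M prob_algebra (step_space M)"
    by (rule measurable_bind_prob_space2[OF polh]) measurable
  have "(\<integral>\<^sup>+p. g p \<partial>step_law M \<pi> x0 t h) =
    (\<integral>\<^sup>+x. (\<integral>\<^sup>+p. g p \<partial>(\<pi> t h x \<bind> (\<lambda>a. return (step_space M) (x, a)))) \<partial>state_law M x0 t h)"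
    unfolding step_law_def
    by (rule nn_integral_bind[OF g])
      (use measurable_prob_algebraD[OF b] in \<open>simp add: measurable_cong_sets[OF ss refl]\<close>)
  also have "\<dots> = (\<integral>\<^sup>+x. (\<integral>\<^sup>+a. g (x, a) \<partial>\<pi> t h x) \<partial>state_law M x0 t h)"
  proof (rule nn_integral_cong)
    fix x assume "x \<in> space (state_law M x0 t h)"
    then have x: "x \<in> space (state_space M)" using sets_eq_imp_space_eq[OF ss] by simp
    have sa: "sets (\<pi> t h x) = sets (action_space M)"
      using measurable_space[OF polh x] by (simp add: space_prob_algebra)
    have "(\<lambda>a. return (step_space M) (x, a)) \<in> action_space M \<rightarrow>\<^sub>M subprob_algebra (step_space M)"
      using x by measurable
    then have "(\<integral>\<^sup>+p. g p \<partial>(\<pi> t h x \<bind> (\<lambda>a. return (step_space M) (x, a)))) =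
      (\<integral>\<^sup>+a. (\<integral>\<^sup>+p. g p \<partial>return (step_space M) (x, a)) \<partial>\<pi> t h x)"
      by (intro nn_integral_bind[OF g]) (simp add: measurable_cong_sets[OF sa refl])
    also have "\<dots> = (\<integral>\<^sup>+a. g (x, a) \<partial>\<pi> t h x)"
      using sets_eq_imp_space_eq[OF sa] x g
      by (intro nn_integral_cong nn_integral_return) (auto simp: space_pair_measure)
    finally show "(\<integral>\<^sup>+p. g p \<partial>(\<pi> t h x \<bind> (\<lambda>a. return (step_space M) (x, a)))) = (\<integral>\<^sup>+a. g (x, a) \<partial>\<pi> t h x)" .
  qed
  finally show ?thesis .
qed

section \<open>Hitting times\<close>

lemma hit_le: "fst (\<omega> k) \<in> S \<Longrightarrow> hit S \<omega> \<le> enat k"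
  unfolding hit_def by (rule Inf_lower) blast

text \<open>\<open>enat\<close> is well-ordered, so the infimum of a nonempty set of times belongs
  to it.\<close>

lemma hit_finite:
  assumes "hit S \<omega> < \<infinity>"
  shows "\<exists>k. hit S \<omega> = enat k \<and> fst (\<omega> k) \<in> S"
proof -
  have "enat ` {t. fst (\<omega> t) \<in> S} \<noteq> {}"
  proof
    assume "enat ` {t. fst (\<omega> t) \<in> S} = {}"
    then have "hit S \<omega> = \<infinity>" unfolding hit_def by (simp only: Inf_empty top_enat_def)
    with assms show False by simp
  qed
  then obtain n where "n \<in> enat ` {t. fst (\<omega> t) \<in> S}"
    by blast
  then have "hit S \<omega> \<in> enat ` {t. fst (\<omega> t) \<in> S}"
    unfolding hit_def by (rule wellorder_InfI)
  then show ?thesis by blast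
qed

section \<open>The killed process driven by Markov kernels\<close>

locale markov_process =
  fixes M :: "('x::polish_space, 'a::polish_space) reach_avoid" and \<phi> x0
  assumes model: "reach_avoid_model M"
    and \<phi>: "\<phi> \<in> markov_kernels M"
    and x0: "x0 \<in> states M"
begin

abbreviation "\<pi> \<equiv> killed_policy M \<phi>"
abbreviation "L \<equiv> process_law M \<pi> x0"

lemma policy: "\<pi> \<in> policies M"
  using markov_policies_subset_policies[OF model] \<phi> by (auto simp: markov_policies_def)

sublocale IT: Ionescu_Tulcea "step_law M \<pi> x0" "\<lambda>_. step_space M"
  using Ionescu_Tulcea_step_law[OF model policy x0] .

lemma L_eq: "L = IT.PF.lim"
  by (simp add: process_law_def)

lemma sets_L [measurable_cong]: "sets L = sets (PiM UNIV (\<lambda>_. step_space M))"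
  by (simp add: L_eq)

lemma space_L: "space L = space (PiM UNIV (\<lambda>_. step_space M))"
  by (simp add: L_eq)

lemma state_in_states: "\<omega> \<in> space L \<Longrightarrow> fst (\<omega> t) \<in> states M"
  by (auto simp: space_L space_PiM space_pair_measure PiE_iff mem_Times_iff)

text \<open>The total mass is read off the marginal over the empty index set, whose cylinder is the
  whole path space.\<close>

lemma prob_space_L: "prob_space L"
proof
  have "emeasure L (space L) = emeasure IT.PF.lim (prod_emb UNIV (\<lambda>_. step_space M) {} (space (PiM {} (\<lambda>_. step_space M))))"
    by (simp add: L_eq prod_emb_def space_PiM restrict_def)
  also have "\<dots> = emeasure (IT.CI {}) (space (IT.CI {}))"
    by (subst IT.lim) (auto simp: IT.CI_def)
  also have "\<dots> = 1"
    by (rule prob_space.emeasure_space_1) (rule IT.PF.prob_space_P, auto)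
  finally show "emeasure L (space L) = 1" .
qed

lemma live_sets [measurable]: "live M \<in> sets (state_space M)"
  using live_in_sets[OF model] .

lemma target_sets [measurable]: "target M \<in> sets (state_space M)"
  using model by (simp add: reach_avoid_model_def)

lemma pred_alive [measurable]: "Measurable.pred (PiM UNIV (\<lambda>_. step_space M)) (alive M k)"
  unfolding alive_def by measurable

text \<open>\<open>alive M k\<close> depends only on coordinates before \<open>k\<close>, so in the
  one-step disintegration at time \<open>k\<close> it leaves the inner integral as a factor; what
  remains is an integral over the conditional law of the state and then over that of the
  action.\<close>

lemma alive_step:
  assumes g[measurable]: "g \<in> borel_measurable (step_space M)"
  shows "(\<integral>\<^sup>+\<omega>. indicator {\<omega>. alive M k \<omega>} \<omega> * g (\<omega> k) \<partial>L) =
    (\<integral>\<^sup>+\<omega>. indicator {\<omega>. alive M k \<omega>} \<omega> *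
      (\<integral>\<^sup>+x. (\<integral>\<^sup>+a. g (x, a) \<partial>\<pi> k (restrict \<omega> {0..<k}) x) \<partial>state_law M x0 k (restrict \<omega> {0..<k})) \<partial>L)"
proof -
  let ?f = "\<lambda>h. indicator {h. alive M k h} h * g (h k)"
  have [measurable]: "(\<lambda>h. h s) \<in> PiM {0..<Suc k} (\<lambda>_. step_space M) \<rightarrow>\<^sub>M step_space M" if "s \<le> k" for s
    using that by (intro measurable_component_singleton) auto
  have [measurable]: "Measurable.pred (PiM {0..<Suc k} (\<lambda>_. step_space M)) (alive M k)"
  proof -
    have "Measurable.pred (PiM {0..<Suc k} (\<lambda>_. step_space M)) (\<lambda>h. \<forall>s\<in>{..<k}. fst (h s) \<in> live M)"
      by measurable
    then show ?thesis by (simp add: alive_def[abs_def] Ball_def)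
  qed
  have f: "?f \<in> borel_measurable (PiM {0..<Suc k} (\<lambda>_. step_space M))" by measurable
  have "(\<integral>\<^sup>+\<omega>. indicator {\<omega>. alive M k \<omega>} \<omega> * g (\<omega> k) \<partial>L) = (\<integral>\<^sup>+\<omega>. ?f (restrict \<omega> {0..<Suc k}) \<partial>L)"
    by (intro nn_integral_cong) (auto simp: alive_def indicator_def)
  also have "\<dots> = (\<integral>\<^sup>+\<omega>. (\<integral>\<^sup>+y. ?f ((restrict \<omega> {0..<k})(k := y)) \<partial>step_law M \<pi> x0 k (restrict \<omega> {0..<k})) \<partial>L)"
    unfolding L_eq by (rule IT.nn_integral_lim_step[OF f])
  also have "\<dots> = (\<integral>\<^sup>+\<omega>. indicator {\<omega>. alive M k \<omega>} \<omega> *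
      (\<integral>\<^sup>+x. (\<integral>\<^sup>+a. g (x, a) \<partial>\<pi> k (restrict \<omega> {0..<k}) x) \<partial>state_law M x0 k (restrict \<omega> {0..<k})) \<partial>L)"
  proof (rule nn_integral_cong)
    fix \<omega> assume "\<omega> \<in> space L"
    then have h: "restrict \<omega> {0..<k} \<in> space (PiM {0..<k} (\<lambda>_. step_space M))"
      by (auto simp: space_L space_PiM)
    have "(\<integral>\<^sup>+y. ?f ((restrict \<omega> {0..<k})(k := y)) \<partial>step_law M \<pi> x0 k (restrict \<omega> {0..<k})) =
      (\<integral>\<^sup>+y. indicator {\<omega>. alive M k \<omega>} \<omega> * g y \<partial>step_law M \<pi> x0 k (restrict \<omega> {0..<k}))"
      by (intro nn_integral_cong) (auto simp: alive_def indicator_def)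
    also have "\<dots> = indicator {\<omega>. alive M k \<omega>} \<omega> * (\<integral>\<^sup>+y. g y \<partial>step_law M \<pi> x0 k (restrict \<omega> {0..<k}))"
      by (rule nn_integral_cmult) (simp add: measurable_cong_sets[OF IT.sets_P[OF h] refl] g)
    finally show "(\<integral>\<^sup>+y. ?f ((restrict \<omega> {0..<k})(k := y)) \<partial>step_law M \<pi> x0 k (restrict \<omega> {0..<k})) =
      indicator {\<omega>. alive M k \<omega>} \<omega> * (\<integral>\<^sup>+x. (\<integral>\<^sup>+a. g (x, a) \<partial>\<pi> k (restrict \<omega> {0..<k}) x) \<partial>state_law M x0 k (restrict \<omega> {0..<k}))"
      by (simp add: nn_integral_step_law[OF model policy x0 h g])
  qed
  finally show ?thesis .
qed

lemma policy_prob: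
  assumes "\<omega> \<in> space L" "x \<in> states M"
  shows "prob_space (\<pi> k (restrict \<omega> {0..<k}) x)"
proof -
  have "(restrict \<omega> {0..<k}, x) \<in> space ((PiM {0..<k} (\<lambda>_. step_space M)) \<Otimes>\<^sub>M state_space M)"
    using assms by (auto simp: space_L space_PiM space_pair_measure)
  moreover have "(\<lambda>(h, x). \<pi> k h x)
      \<in> (PiM {0..<k} (\<lambda>_. step_space M)) \<Otimes>\<^sub>M state_space M \<rightarrow>\<^sub>M prob_algebra (action_space M)"
    using policy unfolding policies_def by blast
  ultimately have "(\<lambda>(h, x). \<pi> k h x) (restrict \<omega> {0..<k}, x) \<in> space (prob_algebra (action_space M))"
    by (rule measurable_space[rotated])
  then show ?thesis by (simp only: case_prod_conv space_prob_algebra mem_Collect_eq)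
qed

lemma space_state_law: "\<omega> \<in> space L \<Longrightarrow> space (state_law M x0 k (restrict \<omega> {0..<k})) = states M"
proof -
  assume "\<omega> \<in> space L"
  then have h: "restrict \<omega> {0..<k} \<in> space (PiM {0..<k} (\<lambda>_. step_space M))"
    by (auto simp: space_L space_PiM)
  have "sets (state_law M x0 k (restrict \<omega> {0..<k})) = sets (state_space M)"
    using measurable_space[OF measurable_state_law[OF model x0] h] by (simp add: space_prob_algebra)
  from sets_eq_imp_space_eq[OF this] show ?thesis by simp
qed

text \<open>The instance of \<open>alive_step\<close> in which the action integrates out to total
  mass \<open>1\<close>.\<close>

lemma alive_step_state:
  assumes W: "W \<in> borel_measurable (state_space M)"
  shows "(\<integral>\<^sup>+\<omega>. indicator {\<omega>. alive M k \<omega>} \<omega> * W (fst (\<omega> k)) \<partial>L) =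
    (\<integral>\<^sup>+\<omega>. indicator {\<omega>. alive M k \<omega>} \<omega> * (\<integral>\<^sup>+x. W x \<partial>state_law M x0 k (restrict \<omega> {0..<k})) \<partial>L)"
proof -
  have "(\<lambda>p. W (fst p)) \<in> borel_measurable (step_space M)" using W by measurable
  note alive_step[OF this, of k]
  also have "(\<integral>\<^sup>+\<omega>. indicator {\<omega>. alive M k \<omega>} \<omega> *
      (\<integral>\<^sup>+x. (\<integral>\<^sup>+a. W (fst (x, a)) \<partial>\<pi> k (restrict \<omega> {0..<k}) x) \<partial>state_law M x0 k (restrict \<omega> {0..<k})) \<partial>L) =
    (\<integral>\<^sup>+\<omega>. indicator {\<omega>. alive M k \<omega>} \<omega> * (\<integral>\<^sup>+x. W x \<partial>state_law M x0 k (restrict \<omega> {0..<k})) \<partial>L)"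
    by (intro nn_integral_cong arg_cong2[where f="(*)"])
      (auto simp: space_state_law policy_prob prob_space.emeasure_space_1)
  finally show ?thesis .
qed

lemma measurable_kernel_value [measurable]:
  assumes "W \<in> borel_measurable (state_space M)"
  shows "kernel_value M (\<phi> k) W \<in> borel_measurable (state_space M)"
proof -
  have nv: "next_value M W \<in> borel_measurable (step_space M)"
    by (rule measurable_next_value[OF model assms])
  have ph: "\<phi> k \<in> restrict_space (state_space M) (live M) \<rightarrow>\<^sub>M prob_algebra (action_space M)"
    using \<phi> by (simp add: markov_kernels_def)
  have "(\<lambda>x. \<integral>\<^sup>+a. next_value M W (x, a) \<partial>\<phi> k x) \<in> borel_measurable (restrict_space (state_space M) (live M))"
  proof (rule nn_integral_measurable_subprob_algebra2[OF _ measurable_prob_algebraD[OF ph]])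
    show "(\<lambda>(x, a). next_value M W (x, a)) \<in> borel_measurable (restrict_space (state_space M) (live M) \<Otimes>\<^sub>M action_space M)"
      unfolding case_prod_eta
    proof (rule measurable_compose[OF _ nv])
      show "(\<lambda>p. p) \<in> restrict_space (state_space M) (live M) \<Otimes>\<^sub>M action_space M \<rightarrow>\<^sub>M step_space M"
        by (subst measurable_pair_iff)
          (auto simp: comp_def intro!: measurable_compose[OF measurable_fst] measurable_restrict_space1)
    qed
  qed
  then show ?thesis
    unfolding kernel_value_def[abs_def]
    using sets.sets_into_space[OF live_sets]
    by (subst measurable_If_restrict_space_iff) (auto simp: Int_def[symmetric] Int_absorb1)
qed

text \<open>The one-step Markov property of the killed process. Being alive at \<open>Suc k\<close>
  means being alive at \<open>k\<close> in a live state, and there the killed policy draws the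
  action from \<open>\<phi> k\<close>, which depends on the current state only.\<close>

lemma alive_Suc_value:
  assumes W: "W \<in> borel_measurable (state_space M)"
  shows "(\<integral>\<^sup>+\<omega>. indicator {\<omega>. alive M (Suc k) \<omega>} \<omega> * W (fst (\<omega> (Suc k))) \<partial>L) =
    (\<integral>\<^sup>+\<omega>. indicator {\<omega>. alive M k \<omega>} \<omega> * kernel_value M (\<phi> k) W (fst (\<omega> k)) \<partial>L)"
proof -
  note [measurable] = measurable_next_value[OF model W]
  \<comment> \<open>The indicator carries the requirement that the state at time \<open>k\<close> is
    live, which is the difference between \<open>alive M (Suc k)\<close> and
    \<open>alive M k\<close>.\<close>
  let ?g = "\<lambda>p. indicator (live M) (fst p) * next_value M W p"
  have g: "?g \<in> borel_measurable (step_space M)" by measurable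
  have "(\<integral>\<^sup>+\<omega>. indicator {\<omega>. alive M (Suc k) \<omega>} \<omega> * W (fst (\<omega> (Suc k))) \<partial>L) =
    (\<integral>\<^sup>+\<omega>. indicator {\<omega>. alive M k \<omega>} \<omega> * ?g (\<omega> k) \<partial>L)"
    unfolding alive_step_state[OF W]
    by (intro nn_integral_cong)
      (auto simp: state_law_def next_value_def alive_def less_Suc_eq indicator_def)
  also have "\<dots> = (\<integral>\<^sup>+\<omega>. indicator {\<omega>. alive M k \<omega>} \<omega> *
      (\<integral>\<^sup>+x. (\<integral>\<^sup>+a. ?g (x, a) \<partial>\<pi> k (restrict \<omega> {0..<k}) x) \<partial>state_law M x0 k (restrict \<omega> {0..<k})) \<partial>L)"
    by (rule alive_step[OF g])
  also have "\<dots> = (\<integral>\<^sup>+\<omega>. indicator {\<omega>. alive M k \<omega>} \<omega> *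
      (\<integral>\<^sup>+x. kernel_value M (\<phi> k) W x \<partial>state_law M x0 k (restrict \<omega> {0..<k})) \<partial>L)"
  proof (rule nn_integral_cong)
    fix \<omega> assume "\<omega> \<in> space L"
    \<comment> \<open>On \<open>alive M k\<close> the history condition of
      \<open>killed_policy\<close> holds, so \<open>\<phi> k\<close> is used at live states; at
      other states both sides are \<open>0\<close>.\<close>
    have "(\<integral>\<^sup>+a. ?g (x, a) \<partial>\<pi> k (restrict \<omega> {0..<k}) x) = kernel_value M (\<phi> k) W x" if "alive M k \<omega>" for x
      using that by (auto simp: kernel_value_def killed_policy_def alive_def)
    then show "indicator {\<omega>. alive M k \<omega>} \<omega> *
      (\<integral>\<^sup>+x. (\<integral>\<^sup>+a. ?g (x, a) \<partial>\<pi> k (restrict \<omega> {0..<k}) x) \<partial>state_law M x0 k (restrict \<omega> {0..<k})) =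
      indicator {\<omega>. alive M k \<omega>} \<omega> * (\<integral>\<^sup>+x. kernel_value M (\<phi> k) W x \<partial>state_law M x0 k (restrict \<omega> {0..<k}))"
      by (auto simp: indicator_def)
  qed
  also have "\<dots> = (\<integral>\<^sup>+\<omega>. indicator {\<omega>. alive M k \<omega>} \<omega> * kernel_value M (\<phi> k) W (fst (\<omega> k)) \<partial>L)"
    by (rule alive_step_state[OF measurable_kernel_value[OF W], symmetric])
  finally show ?thesis .
qed

section \<open>Expected values along the killed process\<close>

definition stopped_value :: "('x \<Rightarrow> ennreal) \<Rightarrow> nat \<Rightarrow> ennreal" where
  "stopped_value W k = (\<integral>\<^sup>+\<omega>. indicator {\<omega>. alive M k \<omega>} \<omega> * W (fst (\<omega> k)) \<partial>L)"

text \<open>The probability that the target is visited at time \<open>k\<close> with all earlier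
  states live, that is, for the first time and before the cemetery.\<close>

abbreviation "hit_at \<equiv> stopped_value (indicator (target M))"

lemma stopped_value_0:
  assumes W: "W \<in> borel_measurable (state_space M)"
  shows "stopped_value W 0 = W x0"
proof -
  have "stopped_value W 0 = (\<integral>\<^sup>+\<omega>. (\<integral>\<^sup>+x. W x \<partial>state_law M x0 0 (restrict \<omega> {0..<0})) \<partial>L)"
    unfolding stopped_value_def alive_step_state[OF W]
    by (intro nn_integral_cong) (simp add: alive_def)
  also have "\<dots> = (\<integral>\<^sup>+\<omega>. W x0 \<partial>L)"
    using x0 by (simp only: state_law_def simp_thms if_True nn_integral_return[OF _ W] space_state_space)
  also have "\<dots> = W x0"
    using prob_space.emeasure_space_1[OF prob_space_L] by (simp only: nn_integral_const mult_1_right)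
  finally show ?thesis .
qed

lemma measurable_alive_value:
  assumes [measurable]: "W \<in> borel_measurable (state_space M)"
  shows "(\<lambda>\<omega>. indicator {\<omega>. alive M k \<omega>} \<omega> * W (fst (\<omega> k)) :: ennreal) \<in> borel_measurable L"
  by measurable

text \<open>Integrates one step of the kernels at time \<open>k\<close>: by
  \<open>alive_Suc_value\<close> the kernel term becomes the stopped value one step later.\<close>

lemma stopped_value_eq:
  assumes W: "W \<in> borel_measurable (state_space M)"
  shows "(\<integral>\<^sup>+\<omega>. indicator {\<omega>. alive M k \<omega>} \<omega> *
      (indicator (target M) (fst (\<omega> k)) + kernel_value M (\<phi> k) W (fst (\<omega> k))) \<partial>L) =
    hit_at k + stopped_value W (Suc k)"
proof -
  note 1 = measurable_alive_value[OF borel_measurable_indicator[OF target_sets], of k]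
  note 2 = measurable_alive_value[OF measurable_kernel_value[OF W], of k]
  show ?thesis
    unfolding stopped_value_def alive_Suc_value[OF W] distrib_left by (rule nn_integral_add[OF 1 2])
qed

lemma superharmonic_step:
  assumes W: "W \<in> borel_measurable (state_space M)"
    and super: "\<And>x. x \<in> states M \<Longrightarrow> indicator (target M) x + kernel_value M (\<phi> k) W x \<le> W x"
  shows "hit_at k + stopped_value W (Suc k) \<le> stopped_value W k"
  unfolding stopped_value_eq[OF W, symmetric] stopped_value_def[of W k]
  by (rule nn_integral_mono, rule mult_left_mono, rule super, erule state_in_states, rule zero_le)

lemma harmonic_step:
  assumes W: "W \<in> borel_measurable (state_space M)"
    and harm: "\<And>x. x \<in> states M \<Longrightarrow> indicator (target M) x + kernel_value M (\<phi> k) W x = W x"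
  shows "hit_at k + stopped_value W (Suc k) = stopped_value W k"
  unfolding stopped_value_eq[OF W, symmetric] stopped_value_def[of W k]
  by (rule nn_integral_cong, subst harm, erule state_in_states, rule refl)

text \<open>The step inequalities telescope and the nonnegative remainder
  \<open>stopped_value W (n + m)\<close> is dropped. The offset \<open>m\<close> is \<open>0\<close>
  for the bound by \<open>W\<close> and \<open>1\<close> when the first step is kept exact.\<close>

lemma superharmonic_sum:
  assumes W: "W \<in> borel_measurable (state_space M)"
    and super: "\<And>k x. x \<in> states M \<Longrightarrow> indicator (target M) x + kernel_value M (\<phi> k) W x \<le> W x"
  shows "(\<Sum>k. hit_at (k + m)) \<le> stopped_value W m"
proof -
  have "(\<Sum>k<n. hit_at (k + m)) + stopped_value W (n + m) \<le> stopped_value W m" for n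
  proof (induction n)
    case (Suc n)
    have "(\<Sum>k<Suc n. hit_at (k + m)) + stopped_value W (Suc n + m) \<le>
      (\<Sum>k<n. hit_at (k + m)) + stopped_value W (n + m)"
      using superharmonic_step[OF W super, of "n + m"] by (simp add: add.assoc add_left_mono)
    with Suc show ?case by (rule order_trans[rotated])
  qed simp
  then have "(\<Sum>k<n. hit_at (k + m)) \<le> stopped_value W m" for n
    by (meson add_increasing2 order_refl order_trans zero_le)
  then show ?thesis
    by (intro suminf_le_const) auto
qed

text \<open>Equality in each step leaves an exact identity at every finite horizon; the remainder is
  kept because its limit has to be determined separately.\<close>

lemma harmonic_sum:
  assumes W: "W \<in> borel_measurable (state_space M)"
    and harm: "\<And>k x. x \<in> states M \<Longrightarrow> indicator (target M) x + kernel_value M (\<phi> k) W x = W x"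
  shows "(\<Sum>k<n. hit_at k) + stopped_value W n = W x0"
proof (induction n)
  case (Suc n)
  then show ?case
    using harmonic_step[OF W harm, of n] by (simp add: add.assoc)
qed (simp add: stopped_value_0[OF W])

text \<open>Continuity from above: surviving at all times contradicts a finite value of
  \<open>tau\<close> or \<open>tau'\<close>, since the target and the cemetery lie outside
  \<open>live M\<close>.\<close>

lemma alive_tendsto_0:
  assumes exits: "AE \<omega> in L. min (tau M \<omega>) (tau' M \<omega>) < \<infinity>"
  shows "(\<lambda>n. emeasure L {\<omega> \<in> space L. alive M n \<omega>}) \<longlonglongrightarrow> 0"
proof -
  interpret prob_space L by (rule prob_space_L)
  have m[measurable]: "{\<omega> \<in> space L. alive M n \<omega>} \<in> sets L" for n
    by measurable
  have "(\<lambda>n. emeasure L {\<omega> \<in> space L. alive M n \<omega>}) \<longlonglongrightarrow> emeasure L (\<Inter>n. {\<omega> \<in> space L. alive M n \<omega>})"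
    using m by (intro Lim_emeasure_decseq) (auto simp: decseq_def alive_def)
  moreover have ae: "AE \<omega> in L. \<omega> \<notin> (\<Inter>n. {\<omega> \<in> space L. alive M n \<omega>})"
    using exits
  proof eventually_elim
    case (elim \<omega>)
    then consider "hit (target M) \<omega> < \<infinity>" | "hit (states M - safe M) \<omega> < \<infinity>"
      unfolding tau_def tau'_def by (auto simp only: min_less_iff_disj)
    then obtain t where "fst (\<omega> t) \<notin> live M"
      by cases (auto simp only: live_def dest!: hit_finite)
    then have "\<not> alive M (Suc t) \<omega>" by (auto simp: alive_def)
    then show ?case by auto
  qed
  have "(\<Inter>n. {\<omega> \<in> space L. alive M n \<omega>}) \<in> null_sets L"
    using ae m by (subst AE_iff_null_sets) (auto intro!: sets.countable_INT'')
  ultimately show ?thesis by (simp add: null_setsD1)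
qed

section \<open>The reach-avoid event split by first hitting time\<close>

lemma reach_event:
  assumes \<omega>: "\<omega> \<in> space L"
  shows "tau M \<omega> < tau' M \<omega> \<and> tau M \<omega> < \<infinity> \<longleftrightarrow> (\<exists>k. alive M k \<omega> \<and> fst (\<omega> k) \<in> target M)"
proof
  assume "\<exists>k. alive M k \<omega> \<and> fst (\<omega> k) \<in> target M"
  then obtain k where k: "alive M k \<omega>" "fst (\<omega> k) \<in> target M" by blast
  have 1: "tau M \<omega> \<le> enat k" unfolding tau_def by (rule hit_le[of \<omega> k, OF k(2)])
  \<comment> \<open>The bound is \<open>Suc k\<close> rather than \<open>k\<close>, since the state
    at time \<open>k\<close> lies in the target and hence in the safe set; this yields the strict
    inequality between the hitting times.\<close>
  have 2: "enat (Suc k) \<le> tau' M \<omega>"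
    unfolding tau'_def hit_def
  proof (rule Inf_greatest, clarify)
    fix t assume t: "fst (\<omega> t) \<in> states M" "fst (\<omega> t) \<notin> safe M"
    have "target M \<subset> safe M" using model by (simp add: reach_avoid_model_def)
    then have "\<not> t < k" "t \<noteq> k" using k t by (auto simp: alive_def live_def)
    then show "enat (Suc k) \<le> enat t" by auto
  qed
  have "enat k < enat (Suc k)" by simp
  with 1 2 have "tau M \<omega> < tau' M \<omega>" by order
  moreover have "tau M \<omega> < \<infinity>" using 1 by (rule le_less_trans) simp
  ultimately show "tau M \<omega> < tau' M \<omega> \<and> tau M \<omega> < \<infinity>" by blast
next
  assume *: "tau M \<omega> < tau' M \<omega> \<and> tau M \<omega> < \<infinity>"
  then obtain k where k: "tau M \<omega> = enat k" "fst (\<omega> k) \<in> target M"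
    unfolding tau_def by (blast dest: hit_finite)
  have "fst (\<omega> s) \<in> live M" if s: "s < k" for s
  proof -
    have "enat s < enat k" using s by simp
    with k(1) have "fst (\<omega> s) \<notin> target M"
      using hit_le[of \<omega> s "target M"] by (auto simp: tau_def)
    moreover have "fst (\<omega> s) \<in> safe M"
    proof (rule ccontr)
      assume "fst (\<omega> s) \<notin> safe M"
      then have "tau' M \<omega> \<le> enat s"
        unfolding tau'_def using state_in_states[OF \<omega>, of s] by (intro hit_le) blast
      then have "tau' M \<omega> < tau M \<omega>"
        unfolding k(1) using \<open>enat s < enat k\<close> by (rule le_less_trans)
      with * show False by (blast dest: less_asym)
    qed
    ultimately show ?thesis by (simp add: live_def)
  qed
  with k(2) show "\<exists>k. alive M k \<omega> \<and> fst (\<omega> k) \<in> target M" unfolding alive_def by blast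
qed

text \<open>The event is the union over \<open>k\<close> of the first visits to the target at time
  \<open>k\<close>; these are disjoint because a target state is not live.\<close>

lemma reach_prob_eq: "ennreal (reach_prob M \<pi> x0) = (\<Sum>k. hit_at k)"
proof -
  interpret prob_space L by (rule prob_space_L)
  define E where "E k = {\<omega> \<in> space L. alive M k \<omega> \<and> fst (\<omega> k) \<in> target M}" for k
  have E[measurable]: "E k \<in> sets L" for k unfolding E_def by measurable
  have "ennreal (reach_prob M \<pi> x0) = emeasure L (\<Union>k. E k)"
    unfolding reach_prob_def emeasure_eq_measure[symmetric]
    unfolding E_def using reach_event by (intro arg_cong[where f="emeasure L"]) blast
  also have "\<dots> = (\<Sum>k. emeasure L (E k))"
  proof (rule suminf_emeasure[symmetric])
    have "E i \<inter> E j = {}" if "i < j" for i j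
      using that by (auto simp: E_def alive_def live_def)
    then show "disjoint_family E"
      unfolding disjoint_family_on_def by (metis Int_commute linorder_neqE_nat)
  qed auto
  also have "\<dots> = (\<Sum>k. hit_at k)"
  proof (intro suminf_cong)
    fix k
    have "emeasure L (E k) = (\<integral>\<^sup>+\<omega>. indicator (E k) \<omega> \<partial>L)" by simp
    also have "\<dots> = hit_at k"
      unfolding stopped_value_def by (intro nn_integral_cong) (auto simp: E_def indicator_def)
    finally show "emeasure L (E k) = hit_at k" .
  qed
  finally show ?thesis .
qed

section \<open>Comparison of reach probabilities with value functions\<close>

lemma superharmonic_dominates:
  assumes W: "W \<in> borel_measurable (state_space M)"
    and super: "\<And>k x. x \<in> states M \<Longrightarrow> indicator (target M) x + kernel_value M (\<phi> k) W x \<le> W x"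
  shows "ennreal (reach_prob M \<pi> x0) \<le> W x0"
  using superharmonic_sum[OF W super, of 0] by (simp add: reach_prob_eq stopped_value_0[OF W])

text \<open>The term of time \<open>0\<close> is kept and only the later terms are bounded, with
  offset \<open>1\<close>. The resulting bound is at most \<open>W x0\<close> and still depends on
  the kernel used at time \<open>0\<close>, which the converse for optimal selectors
  exploits.\<close>

lemma superharmonic_first_step:
  assumes W: "W \<in> borel_measurable (state_space M)"
    and super: "\<And>k x. x \<in> states M \<Longrightarrow> indicator (target M) x + kernel_value M (\<phi> k) W x \<le> W x"
  shows "ennreal (reach_prob M \<pi> x0) \<le> indicator (target M) x0 + kernel_value M (\<phi> 0) W x0"
proof -
  have "ennreal (reach_prob M \<pi> x0) = hit_at 0 + (\<Sum>k. hit_at (k + 1))"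
    unfolding reach_prob_eq using suminf_offset[of hit_at 1] by simp
  also have "\<dots> \<le> hit_at 0 + stopped_value W 1"
    by (intro add_left_mono superharmonic_sum[OF W super])
  also have "stopped_value W 1 = stopped_value (kernel_value M (\<phi> 0) W) 0"
    unfolding stopped_value_def using alive_Suc_value[OF W, of 0] by simp
  finally show ?thesis
    unfolding stopped_value_0[OF measurable_kernel_value[OF W]]
      stopped_value_0[OF borel_measurable_indicator[OF target_sets]] .
qed

text \<open>Since \<open>W \<le> 1\<close>, the remainder in \<open>harmonic_sum\<close> is at most
  the probability of being alive, which tends to \<open>0\<close>.\<close>

lemma harmonic_attained:
  assumes W: "W \<in> borel_measurable (state_space M)"
    and harm: "\<And>k x. x \<in> states M \<Longrightarrow> indicator (target M) x + kernel_value M (\<phi> k) W x = W x"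
    and bound: "\<And>x. x \<in> states M \<Longrightarrow> W x \<le> 1"
    and exits: "AE \<omega> in L. min (tau M \<omega>) (tau' M \<omega>) < \<infinity>"
  shows "ennreal (reach_prob M \<pi> x0) = W x0"
proof -
  have "stopped_value W n \<le> emeasure L {\<omega> \<in> space L. alive M n \<omega>}" for n
  proof -
    have "stopped_value W n \<le> (\<integral>\<^sup>+\<omega>. indicator {\<omega> \<in> space L. alive M n \<omega>} \<omega> \<partial>L)"
      unfolding stopped_value_def
      by (intro nn_integral_mono) (auto simp: indicator_def bound state_in_states)
    then show ?thesis by simp
  qed
  then have "(\<lambda>n. stopped_value W n) \<longlonglongrightarrow> 0"
    by (intro tendsto_sandwich[OF _ _ tendsto_const alive_tendsto_0[OF exits]]) auto
  moreover have "(\<lambda>n. \<Sum>k<n. hit_at k) \<longlonglongrightarrow> (\<Sum>k. hit_at k)"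
    by (rule summable_LIMSEQ) auto
  ultimately have "(\<lambda>n. (\<Sum>k<n. hit_at k) + stopped_value W n) \<longlonglongrightarrow> (\<Sum>k. hit_at k) + 0"
    by (intro tendsto_add)
  then have "(\<lambda>n. W x0) \<longlonglongrightarrow> (\<Sum>k. hit_at k)"
    by (simp add: harmonic_sum[OF W harm])
  then show ?thesis
    unfolding reach_prob_eq by (rule LIMSEQ_unique[OF _ tendsto_const])
qed

end

section \<open>The Bellman operator\<close>

text \<open>The class of the minimality claim in pointwise form, suited to showing that the Bellman
  operator preserves it.\<close>

definition unit_functions :: "('x::polish_space, 'a::polish_space) reach_avoid \<Rightarrow> ('x \<Rightarrow> real) set" where
  "unit_functions M = {\<psi> \<in> borel_measurable (state_space M).
     (\<forall>x\<in>states M. 0 \<le> \<psi> x \<and> \<psi> x \<le> 1) \<and> (\<forall>x\<in>states M - safe M. \<psi> x = 0)}"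

text \<open>For nonnegative functions the supremum bound in \<open>B_bar\<close> amounts to values
  between \<open>0\<close> and \<open>1\<close>. The state space has to be nonempty because
  \<open>SUP\<close> over an empty set of reals is unspecified.\<close>

lemma unit_functions_eq:
  assumes "states M \<noteq> {}"
  shows "B_bar M \<inter> bdd_meas_nonneg M = unit_functions M"
proof (intro equalityI subsetI)
  fix \<psi> assume \<psi>: "\<psi> \<in> B_bar M \<inter> bdd_meas_nonneg M"
  then have b: "bounded (\<psi> ` states M)" and s: "(SUP x\<in>states M. \<bar>\<psi> x\<bar>) \<le> 1"
    by (simp_all add: B_bar_def)
  from b obtain c where c: "\<And>x. x \<in> states M \<Longrightarrow> \<bar>\<psi> x\<bar> \<le> c"
    unfolding bounded_iff by auto
  have "\<bar>\<psi> x\<bar> \<le> (SUP x\<in>states M. \<bar>\<psi> x\<bar>)" if "x \<in> states M" for x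
    using that c by (intro cSUP_upper bdd_aboveI2[of _ _ c]) auto
  then have "\<bar>\<psi> x\<bar> \<le> 1" if "x \<in> states M" for x
    using that s by force
  with \<psi> show "\<psi> \<in> unit_functions M"
    by (force simp: unit_functions_def B_bar_def bdd_meas_nonneg_def bdd_meas_def)
next
  fix \<psi> assume \<psi>: "\<psi> \<in> unit_functions M"
  then have "bounded (\<psi> ` states M)"
    by (intro boundedI[of _ 1]) (auto simp: unit_functions_def)
  moreover have "(SUP x\<in>states M. \<bar>\<psi> x\<bar>) \<le> 1"
    using assms \<psi> by (intro cSUP_least) (auto simp: unit_functions_def)
  ultimately show "\<psi> \<in> B_bar M \<inter> bdd_meas_nonneg M"
    using \<psi> by (simp add: unit_functions_def B_bar_def bdd_meas_nonneg_def bdd_meas_def)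
qed

section \<open>One-step integrals under the regularity assumptions\<close>

locale regular_model =
  fixes M :: "('x::polish_space, 'a::polish_space) reach_avoid"
  assumes model: "reach_avoid_model M"
    and compact_valued: "\<And>x. x \<in> live M \<Longrightarrow> compact (feasible M x)"
    and uhc: "upper_hemicontinuous (live M) (actions M) (feasible M)"
    and feller: "strongly_Feller M"
begin

lemma live_states: "x \<in> live M \<Longrightarrow> x \<in> states M"
  using live_subset_states[OF model] by blast

lemma live_sets [measurable]: "live M \<in> sets (state_space M)"
  using live_in_sets[OF model] .

lemma target_sets [measurable]: "target M \<in> sets (state_space M)"
  using model by (simp add: reach_avoid_model_def)

lemma safe_sets [measurable]: "safe M \<in> sets (state_space M)"
  using model by (simp add: reach_avoid_model_def)

lemma target_safe: "x \<in> target M \<Longrightarrow> x \<in> safe M"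
  using model by (auto simp: reach_avoid_model_def)

lemma feasible_sets: "x \<in> states M \<Longrightarrow> feasible M x \<in> sets (action_space M)"
  using model by (simp add: reach_avoid_model_def)

lemma feasible_nonempty: "x \<in> states M \<Longrightarrow> feasible M x \<noteq> {}"
  using model by (simp add: reach_avoid_model_def)

lemma feasible_actions: "x \<in> states M \<Longrightarrow> feasible M x \<subseteq> actions M"
  using sets.sets_into_space[OF feasible_sets] by simp

lemma kernel_prob:
  assumes "x \<in> states M" "a \<in> feasible M x"
  shows "prob_space (kernel M (x, a))" "sets (kernel M (x, a)) = sets (state_space M)"
    "space (kernel M (x, a)) = states M"
proof -
  have "(x, a) \<in> space (restrict_space (step_space M) (feasible_pairs M))"
    using assms feasible_actions[OF assms(1)]
    by (auto simp: space_restrict_space feasible_pairs_def space_pair_measure)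
  moreover have "kernel M \<in> restrict_space (step_space M) (feasible_pairs M) \<rightarrow>\<^sub>M prob_algebra (state_space M)"
    using model by (simp add: reach_avoid_model_def)
  ultimately have "kernel M (x, a) \<in> space (prob_algebra (state_space M))"
    by (rule measurable_space[rotated])
  then show "prob_space (kernel M (x, a))" and s: "sets (kernel M (x, a)) = sets (state_space M)"
    by (simp_all add: space_prob_algebra)
  show "space (kernel M (x, a)) = states M"
    using sets_eq_imp_space_eq[OF s] by simp
qed

lemma unit_functionsD:
  assumes "\<psi> \<in> unit_functions M"
  shows "\<psi> \<in> borel_measurable (state_space M)" "x \<in> states M \<Longrightarrow> 0 \<le> \<psi> x" "x \<in> states M \<Longrightarrow> \<psi> x \<le> 1"
    "x \<in> states M \<Longrightarrow> x \<notin> safe M \<Longrightarrow> \<psi> x = 0"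
  using assms by (auto simp: unit_functions_def)

text \<open>Members of \<open>unit_functions\<close> vanish off \<open>safe M\<close>, so the
  indicator is absorbed.\<close>

lemma bellman_int_eq:
  assumes "\<psi> \<in> unit_functions M" "x \<in> states M" "a \<in> feasible M x"
  shows "bellman_int M \<psi> x a = (\<integral>y. \<psi> y \<partial>kernel M (x, a))"
  unfolding bellman_int_def
  using assms(1) by (intro Bochner_Integration.integral_cong refl)
    (auto simp: kernel_prob[OF assms(2,3)] indicator_def unit_functions_def)

lemma integrable_unit:
  assumes "\<psi> \<in> unit_functions M" "x \<in> states M" "a \<in> feasible M x"
  shows "integrable (kernel M (x, a)) \<psi>"
proof -
  interpret prob_space "kernel M (x, a)" using kernel_prob(1)[OF assms(2,3)] .
  have "\<psi> \<in> borel_measurable (kernel M (x, a))"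
    using unit_functionsD(1)[OF assms(1)] by (simp add: measurable_cong_sets[OF kernel_prob(2)[OF assms(2,3)] refl])
  then show ?thesis
    by (rule integrable_const_bound[where B = 1, rotated])
      (auto simp: kernel_prob(3)[OF assms(2,3)] unit_functionsD[OF assms(1)] intro!: AE_I2)
qed

lemma bellman_int_bounds:
  assumes "\<psi> \<in> unit_functions M" "x \<in> states M" "a \<in> feasible M x"
  shows "0 \<le> bellman_int M \<psi> x a" "bellman_int M \<psi> x a \<le> 1"
proof -
  interpret prob_space "kernel M (x, a)" using kernel_prob(1)[OF assms(2,3)] .
  show "0 \<le> bellman_int M \<psi> x a"
    unfolding bellman_int_eq[OF assms]
    by (rule integral_nonneg_AE) (auto simp: kernel_prob(3)[OF assms(2,3)] unit_functionsD[OF assms(1)] intro!: AE_I2)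
  show "bellman_int M \<psi> x a \<le> 1"
    unfolding bellman_int_eq[OF assms]
    by (rule integral_le_const[OF integrable_unit[OF assms]])
      (auto simp: kernel_prob(3)[OF assms(2,3)] unit_functionsD[OF assms(1)] intro!: AE_I2)
qed

lemma bellman_int_mono:
  assumes "\<psi> \<in> unit_functions M" "\<psi>' \<in> unit_functions M" "\<And>y. y \<in> states M \<Longrightarrow> \<psi> y \<le> \<psi>' y"
    "x \<in> states M" "a \<in> feasible M x"
  shows "bellman_int M \<psi> x a \<le> bellman_int M \<psi>' x a"
  unfolding bellman_int_eq[OF assms(1,4,5)] bellman_int_eq[OF assms(2,4,5)]
  by (intro integral_mono integrable_unit assms) (simp_all add: assms kernel_prob(3)[OF assms(4,5)])

lemma bellman_int_cong:
  assumes "\<And>y. y \<in> states M \<Longrightarrow> \<psi> y = \<psi>' y" "x \<in> states M" "a \<in> feasible M x"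
  shows "bellman_int M \<psi> x a = bellman_int M \<psi>' x a"
  unfolding bellman_int_def
  by (intro Bochner_Integration.integral_cong refl) (simp add: assms kernel_prob(3)[OF assms(2,3)])

lemma next_value_eq:
  assumes "\<psi> \<in> unit_functions M" "x \<in> states M" "a \<in> feasible M x"
  shows "next_value M (\<lambda>y. ennreal (\<psi> y)) (x, a) = ennreal (bellman_int M \<psi> x a)"
proof -
  have "next_value M (\<lambda>y. ennreal (\<psi> y)) (x, a) = (\<integral>\<^sup>+y. ennreal (\<psi> y) \<partial>kernel M (x, a))"
    using assms by (simp add: next_value_def next_state_law_def feasible_pairs_def)
  also have "\<dots> = ennreal (bellman_int M \<psi> x a)"
    unfolding bellman_int_eq[OF assms]
    by (rule nn_integral_eq_integral[OF integrable_unit[OF assms]])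
      (auto simp: kernel_prob(3)[OF assms(2,3)] unit_functionsD[OF assms(1)] intro!: AE_I2)
  finally show ?thesis .
qed

text \<open>A randomized action is an average over feasible actions, which carry full mass under
  \<open>\<phi> k x\<close>; an average cannot exceed a bound valid for each of them.\<close>

lemma kernel_value_le:
  assumes \<phi>: "\<phi> \<in> markov_kernels M" and \<psi>: "\<psi> \<in> unit_functions M" and x: "x \<in> live M"
    and le: "\<And>a. a \<in> feasible M x \<Longrightarrow> bellman_int M \<psi> x a \<le> c"
  shows "kernel_value M (\<phi> k) (\<lambda>y. ennreal (\<psi> y)) x \<le> ennreal c"
proof -
  have xs: "x \<in> states M" using live_states[OF x] .
  have "x \<in> space (restrict_space (state_space M) (live M))"
    using x xs by (simp add: space_restrict_space)
  moreover have "\<phi> k \<in> restrict_space (state_space M) (live M) \<rightarrow>\<^sub>M prob_algebra (action_space M)"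
    using \<phi> by (simp add: markov_kernels_def)
  ultimately have "\<phi> k x \<in> space (prob_algebra (action_space M))"
    by (rule measurable_space[rotated])
  then have p: "prob_space (\<phi> k x)" and s: "sets (\<phi> k x) = sets (action_space M)"
    by (simp_all add: space_prob_algebra)
  interpret prob_space "\<phi> k x" by (rule p)
  have "emeasure (\<phi> k x) (feasible M x) = 1" using \<phi> x by (simp add: markov_kernels_def)
  then have "prob (feasible M x) = 1" by (simp add: measure_def)
  then have ae: "AE a in \<phi> k x. a \<in> feasible M x"
    by (rule AE_prob_1)
  have "kernel_value M (\<phi> k) (\<lambda>y. ennreal (\<psi> y)) x \<le> (\<integral>\<^sup>+a. ennreal c \<partial>\<phi> k x)"
    unfolding kernel_value_def using x
    by (simp only: if_True, intro nn_integral_mono_AE)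
      (use ae in eventually_elim, simp add: next_value_eq[OF \<psi> xs] le ennreal_leI)
  then show ?thesis by (simp add: emeasure_space_1)
qed

section \<open>Stationary policies as Markov kernels\<close>

lemma stationary_kernel:
  assumes "f \<in> selectors M"
  shows "(\<lambda>t x. return (action_space M) (f x)) \<in> markov_kernels M"
proof -
  have f: "f \<in> restrict_space (state_space M) (live M) \<rightarrow>\<^sub>M action_space M"
    and fx: "\<And>x. x \<in> live M \<Longrightarrow> f x \<in> feasible M x"
    using assms by (auto simp: selectors_def)
  have "(\<lambda>x. return (action_space M) (f x)) \<in> restrict_space (state_space M) (live M) \<rightarrow>\<^sub>M prob_algebra (action_space M)"
    by (rule measurable_compose[OF f measurable_return_prob_space])
  then show ?thesis
    by (auto simp: markov_kernels_def emeasure_return feasible_sets live_states fx)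
qed

lemma stationary_policy: "f \<in> selectors M \<Longrightarrow> stationary M f \<in> markov_policies M"
  using stationary_kernel unfolding stationary_def markov_policies_def by blast

lemma kernel_value_stationary:
  assumes f: "f \<in> selectors M" and \<psi>: "\<psi> \<in> unit_functions M" and x: "x \<in> live M"
  shows "kernel_value M (\<lambda>x. return (action_space M) (f x)) (\<lambda>y. ennreal (\<psi> y)) x =
    ennreal (bellman_int M \<psi> x (f x))"
proof -
  have xs: "x \<in> states M" using live_states[OF x] .
  have fx: "f x \<in> feasible M x" using f x by (simp add: selectors_def)
  have fa: "f x \<in> space (action_space M)" using fx feasible_actions[OF xs] by auto
  have "(\<lambda>y. ennreal (\<psi> y)) \<in> borel_measurable (state_space M)"
    using unit_functionsD(1)[OF \<psi>] by measurable
  then have "(\<lambda>a. next_value M (\<lambda>y. ennreal (\<psi> y)) (x, a)) \<in> borel_measurable (action_space M)"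
    using xs by (intro measurable_compose[OF measurable_Pair1' measurable_next_value[OF model]]) simp_all
  from nn_integral_return[OF fa this] show ?thesis
    using x by (simp add: kernel_value_def next_value_eq[OF \<psi> xs fx])
qed

lemma restrict_live: "restrict_space (state_space M) (live M) = restrict_space borel (live M)"
  unfolding state_space_def
  using model live_subset_states[OF model] live_sets
  by (subst restrict_restrict_space) (auto simp: reach_avoid_model_def Int_absorb1 state_space_def sets_restrict_space_iff)

text \<open>The strong Feller property makes the one-step integral continuous in state and action
  although \<open>\<psi>\<close> is only measurable, which is what \<open>maximum_selector\<close>
  asks for. The last conclusion serves the measurability of the Bellman operator.\<close>

lemma maximizing_selector:
  assumes \<psi>: "\<psi> \<in> unit_functions M"
  obtains f where "f \<in> selectors M" "\<And>x. x \<in> live M \<Longrightarrow> attains_max M \<psi> x (f x)"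
    "(\<lambda>x. bellman_int M \<psi> x (f x)) \<in> borel_measurable (restrict_space (state_space M) (live M))"
proof -
  have "(\<lambda>y. indicator (safe M) y * \<psi> y) \<in> bdd_meas M"
    unfolding bdd_meas_def
  proof (intro CollectI conjI)
    show "(\<lambda>y. indicator (safe M) y * \<psi> y) \<in> borel_measurable (state_space M)"
      using unit_functionsD(1)[OF \<psi>] by (intro borel_measurable_times borel_measurable_indicator safe_sets)
    show "bounded ((\<lambda>y. indicator (safe M) y * \<psi> y) ` states M)"
      by (rule boundedI[of _ 1]) (auto simp: indicator_def unit_functionsD[OF \<psi>])
  qed
  then have cont: "continuous_on (SIGMA x:live M. feasible M x) (\<lambda>p. bellman_int M \<psi> (fst p) (snd p))"
    using feller unfolding strongly_Feller_def live_pairs_def bellman_int_def prod.collapse by blast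
  show thesis
  proof (rule maximum_selector[OF uhc compact_valued feasible_nonempty[OF live_states] feasible_actions[OF live_states] cont])
    fix f
    assume f: "f \<in> borel_measurable (restrict_space borel (live M))"
      "\<And>x. x \<in> live M \<Longrightarrow> f x \<in> feasible M x"
      "\<And>x a. x \<in> live M \<Longrightarrow> a \<in> feasible M x \<Longrightarrow>
        bellman_int M \<psi> (fst (x, a)) (snd (x, a)) \<le> bellman_int M \<psi> (fst (x, f x)) (snd (x, f x))"
      "(\<lambda>x. bellman_int M \<psi> (fst (x, f x)) (snd (x, f x))) \<in> borel_measurable (restrict_space borel (live M))"
    have "f \<in> restrict_space borel (live M) \<rightarrow>\<^sub>M action_space M"
      unfolding action_space_def
      using f(2) feasible_actions[OF live_states]
      by (intro measurable_restrict_space2 f(1)) (auto simp: space_restrict_space)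
    then have "f \<in> selectors M"
      using f(2) by (simp add: selectors_def restrict_live)
    then show thesis
      by (rule that) (use f(2-4) in \<open>simp_all add: attains_max_def restrict_live\<close>)
  qed
qed

section \<open>The Bellman operator and value iteration\<close>

definition bellman_op :: "('x \<Rightarrow> real) \<Rightarrow> 'x \<Rightarrow> real" where
  "bellman_op \<psi> x = indicator (target M) x + indicator (live M) x * (SUP a\<in>feasible M x. bellman_int M \<psi> x a)"

lemma SUP_attains_max:
  assumes "attains_max M \<psi> x a"
  shows "(SUP a\<in>feasible M x. bellman_int M \<psi> x a) = bellman_int M \<psi> x a"
  using assms by (intro cSup_eq_maximum) (auto simp: attains_max_def)

text \<open>On live states the supremum equals the integral along a measurable maximizer; this is
  where measurability comes from, as an arbitrary supremum of measurable functions need not be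
  measurable.\<close>

lemma bellman_op_unit:
  assumes \<psi>: "\<psi> \<in> unit_functions M"
  shows "bellman_op \<psi> \<in> unit_functions M"
proof -
  obtain f where f: "f \<in> selectors M" "\<And>x. x \<in> live M \<Longrightarrow> attains_max M \<psi> x (f x)"
    "(\<lambda>x. bellman_int M \<psi> x (f x)) \<in> borel_measurable (restrict_space (state_space M) (live M))"
    using maximizing_selector[OF \<psi>] by blast
  have eq: "bellman_op \<psi> x = (if x \<in> live M then bellman_int M \<psi> x (f x) else indicator (target M) x)" for x
    by (simp add: bellman_op_def SUP_attains_max[OF f(2)]) (simp add: live_def indicator_def)
  have "bellman_op \<psi> \<in> borel_measurable (state_space M)"
    unfolding eq[abs_def]
  proof (subst measurable_If_restrict_space_iff)
    show "{x \<in> space (state_space M). x \<in> live M} \<in> sets (state_space M)" by measurable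
    show "(\<lambda>x. bellman_int M \<psi> x (f x)) \<in> borel_measurable (restrict_space (state_space M) {x. x \<in> live M}) \<and>
      indicator (target M) \<in> borel_measurable (restrict_space (state_space M) {x. x \<notin> live M})"
      using f(3) by (auto intro!: measurable_restrict_space1)
  qed
  moreover have "0 \<le> bellman_op \<psi> x \<and> bellman_op \<psi> x \<le> 1" if "x \<in> states M" for x
    using bellman_int_bounds[OF \<psi> that, of "f x"] f(1) by (auto simp: eq selectors_def)
  moreover have "bellman_op \<psi> x = 0" if "x \<in> states M - safe M" for x
    using that target_safe[of x] by (auto simp: eq live_def indicator_def)
  ultimately show ?thesis by (simp add: unit_functions_def)
qed

lemma bellman_int_le_bellman_op:
  assumes \<psi>: "\<psi> \<in> unit_functions M" and x: "x \<in> live M" "a \<in> feasible M x"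
  shows "bellman_int M \<psi> x a \<le> bellman_op \<psi> x"
proof -
  obtain f where f: "\<And>x. x \<in> live M \<Longrightarrow> attains_max M \<psi> x (f x)"
    using maximizing_selector[OF \<psi>] by blast
  show ?thesis
    using x f[OF x(1)] SUP_attains_max[OF f[OF x(1)]]
    by (simp add: bellman_op_def attains_max_def) (simp add: live_def)
qed

lemma bellman_op_le:
  assumes "x \<in> live M" "\<And>a. a \<in> feasible M x \<Longrightarrow> bellman_int M \<psi> x a \<le> c"
  shows "bellman_op \<psi> x \<le> c"
proof -
  have "(SUP a\<in>feasible M x. bellman_int M \<psi> x a) \<le> c"
    using feasible_nonempty[OF live_states[OF assms(1)]] assms(2) by (rule cSUP_least)
  with assms(1) show ?thesis by (simp add: bellman_op_def) (simp add: live_def)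
qed

lemma bellman_op_not_live: "x \<notin> live M \<Longrightarrow> bellman_op \<psi> x = indicator (target M) x"
  by (simp add: bellman_op_def)

lemma bellman_op_mono:
  assumes \<psi>: "\<psi> \<in> unit_functions M" "\<psi>' \<in> unit_functions M" "\<And>y. y \<in> states M \<Longrightarrow> \<psi> y \<le> \<psi>' y"
  shows "bellman_op \<psi> x \<le> bellman_op \<psi>' x"
proof (cases "x \<in> live M")
  case True
  show ?thesis
    using bellman_int_mono[OF assms live_states[OF True]] bellman_int_le_bellman_op[OF \<psi>(2) True]
    by (intro bellman_op_le[OF True]) (rule order_trans)
qed (simp add: bellman_op_not_live)

text \<open>\<open>maximizing_selector\<close> supplies the attainment clause of
  \<open>bellman_solution\<close>, which leaves the fixed point equation.\<close>

lemma bellman_solution_iff: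
  assumes "\<psi> \<in> unit_functions M"
  shows "bellman_solution M \<psi> \<longleftrightarrow> (\<forall>x\<in>states M. \<psi> x = bellman_op \<psi> x)"
proof -
  obtain f where "\<And>x. x \<in> live M \<Longrightarrow> attains_max M \<psi> x (f x)"
    using maximizing_selector[OF assms] by blast
  then show ?thesis unfolding bellman_solution_def bellman_op_def by blast
qed

lemma bellman_op_fixpoint_exists: "\<exists>\<psi>\<in>unit_functions M. \<forall>x\<in>states M. \<psi> x = bellman_op \<psi> x"
proof -
  define V where "V n = (bellman_op ^^ n) (\<lambda>_. 0)" for n
  have VS: "V (Suc n) = bellman_op (V n)" for n by (simp add: V_def)
  have V: "V n \<in> unit_functions M" for n
  proof (induction n)
    case 0
    show ?case by (simp add: V_def unit_functions_def)
  qed (simp add: VS bellman_op_unit)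
  have Vinc: "V n x \<le> V (Suc n) x" if "x \<in> states M" for n x
    using that
  proof (induction n arbitrary: x)
    case 0
    then show ?case using unit_functionsD(2)[OF V[of 1]] by (simp add: V_def)
  next
    case (Suc n)
    have "bellman_op (V n) x \<le> bellman_op (V (Suc n)) x"
      by (rule bellman_op_mono[OF V V Suc.IH])
    then show ?case by (simp only: VS)
  qed
  define W where "W x = (SUP n. V n x)" for x
  have bdd: "bdd_above (range (\<lambda>n. V n x))" if "x \<in> states M" for x
    using unit_functionsD(3)[OF V that] by (intro bdd_aboveI2) auto
  have VW: "V n x \<le> W x" if "x \<in> states M" for n x
    unfolding W_def by (rule cSUP_upper[OF _ bdd[OF that]]) simp
  have lim: "(\<lambda>n. V n x) \<longlonglongrightarrow> W x" if "x \<in> states M" for x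
    unfolding W_def using Vinc[OF that] by (intro LIMSEQ_incseq_SUP bdd that incseq_SucI) simp
  have W: "W \<in> unit_functions M"
    unfolding unit_functions_def
  proof (intro CollectI conjI ballI)
    show "W \<in> borel_measurable (state_space M)"
      by (rule borel_measurable_LIMSEQ_real[of _ V]) (simp_all add: lim unit_functionsD(1)[OF V])
    fix x assume x: "x \<in> states M"
    show "0 \<le> W x" using VW[OF x, of 0] by (simp add: V_def)
    show "W x \<le> 1" unfolding W_def using unit_functionsD(3)[OF V x] by (intro cSUP_least) simp_all
  next
    fix x assume "x \<in> states M - safe M"
    then have "V n x = 0" for n using unit_functionsD(4)[OF V] by blast
    then show "W x = 0" by (simp add: W_def)
  qed
  have "W x = bellman_op W x" if x: "x \<in> states M" for x
  proof (rule antisym)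
    \<comment> \<open>Each later iterate is the operator applied to a function below
      \<open>W\<close>, so monotonicity suffices for this direction.\<close>
    have "V (Suc n) x \<le> bellman_op W x" for n
      unfolding VS by (intro bellman_op_mono V W VW)
    then show "W x \<le> bellman_op W x"
      using lim[OF x, THEN LIMSEQ_Suc] by (intro LIMSEQ_le_const2) blast+
    show "bellman_op W x \<le> W x"
    proof (cases "x \<in> live M")
      case True
      show ?thesis
      proof (rule bellman_op_le[OF True])
        \<comment> \<open>The action is fixed before the limit is taken: dominated convergence with
          bound \<open>1\<close> treats one action at a time, and the bound \<open>W x\<close> does
          not depend on the action.\<close>
        fix a assume a: "a \<in> feasible M x"
        interpret prob_space "kernel M (x, a)" using kernel_prob(1)[OF x a] .
        have meas: "\<psi> \<in> borel_measurable (kernel M (x, a))" if "\<psi> \<in> unit_functions M" for \<psi>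
          using integrable_unit[OF that x a] by (rule borel_measurable_integrable)
        have "(\<lambda>n. \<integral>y. V n y \<partial>kernel M (x, a)) \<longlonglongrightarrow> (\<integral>y. W y \<partial>kernel M (x, a))"
        proof (rule integral_dominated_convergence[where w = "\<lambda>_. 1"])
          show "AE y in kernel M (x, a). (\<lambda>n. V n y) \<longlonglongrightarrow> W y"
            by (rule AE_I2) (simp add: kernel_prob(3)[OF x a] lim)
          show "AE y in kernel M (x, a). norm (V n y) \<le> 1" for n
            by (rule AE_I2) (simp add: kernel_prob(3)[OF x a] unit_functionsD(2,3)[OF V])
        qed (simp_all add: meas V W)
        then have "(\<lambda>n. bellman_int M (V n) x a) \<longlonglongrightarrow> bellman_int M W x a"
          by (simp add: bellman_int_eq[OF V x a] bellman_int_eq[OF W x a])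
        moreover have "bellman_int M (V n) x a \<le> W x" for n
          using bellman_int_le_bellman_op[OF V True a, of n] VW[OF x, of "Suc n"] by (simp add: VS)
        ultimately show "bellman_int M W x a \<le> W x"
          by (intro LIMSEQ_le_const2) blast+
      qed
    next
      case False
      \<comment> \<open>Off the live states the value \<open>indicator (target M) x\<close> is
        reached after one iteration, so index \<open>1\<close> suffices.\<close>
      then show ?thesis using VW[OF x, of 1] by (simp add: V_def bellman_op_not_live)
    qed
  qed
  with W show ?thesis by blast
qed

section \<open>Solutions as bounds on all Markov policies\<close>

lemma solution_superharmonic:
  assumes \<psi>: "\<psi> \<in> unit_functions M" "\<And>x. x \<in> states M \<Longrightarrow> \<psi> x = bellman_op \<psi> x"
    and \<phi>: "\<phi> \<in> markov_kernels M" and x: "x \<in> states M"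
  shows "indicator (target M) x + kernel_value M (\<phi> k) (\<lambda>y. ennreal (\<psi> y)) x \<le> ennreal (\<psi> x)"
proof (cases "x \<in> live M")
  case True
  have "kernel_value M (\<phi> k) (\<lambda>y. ennreal (\<psi> y)) x \<le> ennreal (\<psi> x)"
    using bellman_int_le_bellman_op[OF \<psi>(1) True] \<psi>(2)[OF x] by (intro kernel_value_le \<phi> \<psi>(1) True) simp
  with True show ?thesis by (simp add: live_def)
next
  case False
  with \<psi>(2)[OF x] show ?thesis by (simp add: bellman_op_not_live kernel_value_def indicator_def)
qed

lemma measurable_ennreal_unit:
  "\<psi> \<in> unit_functions M \<Longrightarrow> (\<lambda>y. ennreal (\<psi> y)) \<in> borel_measurable (state_space M)"
  using unit_functionsD(1)[of \<psi>] by measurable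

lemma reach_prob_le_solution:
  assumes \<psi>: "\<psi> \<in> unit_functions M" "\<And>x. x \<in> states M \<Longrightarrow> \<psi> x = bellman_op \<psi> x"
    and \<pi>: "\<pi> \<in> markov_policies M" and x: "x \<in> states M"
  shows "reach_prob M \<pi> x \<le> \<psi> x"
proof -
  obtain \<phi> where \<phi>: "\<phi> \<in> markov_kernels M" "\<pi> = killed_policy M \<phi>"
    using \<pi> by (auto simp: markov_policies_def)
  interpret P: markov_process M \<phi> x using model \<phi>(1) x by unfold_locales
  have "ennreal (reach_prob M \<pi> x) \<le> ennreal (\<psi> x)"
    unfolding \<phi>(2)
    by (rule P.superharmonic_dominates[OF measurable_ennreal_unit[OF \<psi>(1)]])
      (rule solution_superharmonic[OF \<psi> \<phi>(1)])
  then show ?thesis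
    using unit_functionsD(2)[OF \<psi>(1) x] by (simp add: ennreal_le_iff)
qed

lemma opt_value_le_solution:
  assumes \<psi>: "\<psi> \<in> unit_functions M" "\<And>x. x \<in> states M \<Longrightarrow> \<psi> x = bellman_op \<psi> x"
    and x: "x \<in> states M"
  shows "opt_value M x \<le> \<psi> x"
proof -
  \<comment> \<open>A maximizing selector provides a Markov policy, so the real supremum is taken
    over a nonempty set.\<close>
  obtain f where "f \<in> selectors M" using maximizing_selector[OF \<psi>(1)] by blast
  then have "markov_policies M \<noteq> {}" using stationary_policy by blast
  then show ?thesis
    unfolding opt_value_def by (rule cSUP_least) (rule reach_prob_le_solution[OF \<psi> _ x])
qed

text \<open>A real supremum dominates its members when they are bounded above; a fixed point of the
  Bellman operator supplies the bound.\<close>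

lemma reach_prob_le_opt_value:
  assumes "\<pi> \<in> markov_policies M" "x \<in> states M"
  shows "reach_prob M \<pi> x \<le> opt_value M x"
proof -
  obtain \<psi> where \<psi>: "\<psi> \<in> unit_functions M" "\<And>x. x \<in> states M \<Longrightarrow> \<psi> x = bellman_op \<psi> x"
    using bellman_op_fixpoint_exists by blast
  have "bdd_above ((\<lambda>\<pi>. reach_prob M \<pi> x) ` markov_policies M)"
    using reach_prob_le_solution[OF \<psi> _ assms(2)] by (intro bdd_aboveI2)
  then show ?thesis
    unfolding opt_value_def using assms(1) by (intro cSUP_upper)
qed

text \<open>A maximizing selector turns the Bellman inequality into an equality at every state, so
  \<open>\<psi>\<close> is harmonic for the stationary kernels and \<open>harmonic_attained\<close>
  applies.\<close>

lemma maximizing_selector_attains: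
  assumes \<psi>: "\<psi> \<in> unit_functions M" "\<And>x. x \<in> states M \<Longrightarrow> \<psi> x = bellman_op \<psi> x"
    and f: "f \<in> selectors M" "\<And>x. x \<in> live M \<Longrightarrow> attains_max M \<psi> x (f x)"
    and exits: "\<And>x. x \<in> states M \<Longrightarrow>
      AE \<omega> in process_law M (stationary M f) x. min (tau M \<omega>) (tau' M \<omega>) < \<infinity>"
    and x: "x \<in> states M"
  shows "reach_prob M (stationary M f) x = \<psi> x"
proof -
  interpret P: markov_process M "\<lambda>t x. return (action_space M) (f x)" x
    using model stationary_kernel[OF f(1)] x by unfold_locales
  have "ennreal (reach_prob M (stationary M f) x) = ennreal (\<psi> x)"
    unfolding stationary_def
  proof (rule P.harmonic_attained[OF measurable_ennreal_unit[OF \<psi>(1)]])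
    fix z assume z: "z \<in> states M"
    show "indicator (target M) z + kernel_value M (\<lambda>x. return (action_space M) (f x)) (\<lambda>y. ennreal (\<psi> y)) z =
      ennreal (\<psi> z)"
    proof (cases "z \<in> live M")
      case True
      then have "\<psi> z = bellman_int M \<psi> z (f z)"
        using \<psi>(2)[OF z] SUP_attains_max[OF f(2)[OF True]] by (simp add: bellman_op_def) (simp add: live_def)
      with True show ?thesis
        by (simp add: kernel_value_stationary[OF f(1) \<psi>(1) True]) (simp add: live_def)
    next
      case False
      with \<psi>(2)[OF z] show ?thesis by (simp add: bellman_op_not_live kernel_value_def indicator_def)
    qed
  next
    show "ennreal (\<psi> z) \<le> 1" if "z \<in> states M" for z
      using unit_functionsD(3)[OF \<psi>(1) that] by (simp add: ennreal_le_1)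
  next
    show "AE \<omega> in process_law M (killed_policy M (\<lambda>t x. return (action_space M) (f x))) x.
        min (tau M \<omega>) (tau' M \<omega>) < \<infinity>"
      using exits[OF x] unfolding stationary_def .
  qed
  then show ?thesis
    using unit_functionsD(2)[OF \<psi>(1) x] by (simp add: reach_prob_def)
qed

lemma selector_equation_iff:
  assumes "f \<in> selectors M"
  shows "selector_equation M f \<psi> \<longleftrightarrow>
    (\<forall>x\<in>states M. \<psi> x = indicator (target M) x + indicator (live M) x * bellman_int M \<psi> x (f x))"
  unfolding selector_equation_def bellman_int_def set_lebesgue_integral_def
  by (intro ball_cong refl) (auto simp: indicator_def live_def)

end

section \<open>Optimality under almost sure exit\<close>

locale exiting_model = regular_model +
  assumes exits: "\<And>\<pi> x. \<pi> \<in> markov_policies M \<Longrightarrow> x \<in> states M \<Longrightarrow>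
                  AE \<omega> in process_law M \<pi> x. min (tau M \<omega>) (tau' M \<omega>) < \<infinity>"
begin

text \<open>The stationary policy of a maximizer for \<open>\<psi>\<close> attains
  \<open>\<psi>\<close>, while no Markov policy exceeds it. In particular, the fixed point in
  \<open>unit_functions\<close> is unique on the states.\<close>

lemma solution_eq_opt_value:
  assumes \<psi>: "\<psi> \<in> unit_functions M" "\<And>x. x \<in> states M \<Longrightarrow> \<psi> x = bellman_op \<psi> x"
    and x: "x \<in> states M"
  shows "opt_value M x = \<psi> x"
proof -
  obtain f where f: "f \<in> selectors M" "\<And>x. x \<in> live M \<Longrightarrow> attains_max M \<psi> x (f x)"
    using maximizing_selector[OF \<psi>(1)] by blast
  have "reach_prob M (stationary M f) x = \<psi> x"
    by (rule maximizing_selector_attains[OF \<psi> f exits[OF stationary_policy[OF f(1)]] x])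
  with reach_prob_le_opt_value[OF stationary_policy[OF f(1)] x] opt_value_le_solution[OF \<psi> x]
  show ?thesis by simp
qed

text \<open>Both properties are inherited from the fixed point obtained by value iteration, with
  which \<open>opt_value M\<close> agrees on the states; this avoids proving measurability of a
  supremum over policies directly.\<close>

lemma opt_value_unit:
  shows "opt_value M \<in> unit_functions M" "\<And>x. x \<in> states M \<Longrightarrow> opt_value M x = bellman_op (opt_value M) x"
proof -
  obtain \<psi> where \<psi>: "\<psi> \<in> unit_functions M" "\<And>x. x \<in> states M \<Longrightarrow> \<psi> x = bellman_op \<psi> x"
    using bellman_op_fixpoint_exists by blast
  have eq: "opt_value M x = \<psi> x" if "x \<in> states M" for x
    by (rule solution_eq_opt_value[OF \<psi> that])
  have "opt_value M \<in> borel_measurable (state_space M)"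
    using unit_functionsD(1)[OF \<psi>(1)] eq by (subst measurable_cong[where g = \<psi>]) simp_all
  then show "opt_value M \<in> unit_functions M"
    using \<psi>(1) by (simp add: unit_functions_def eq)
  show "opt_value M x = bellman_op (opt_value M) x" if x: "x \<in> states M" for x
  proof -
    have "(SUP a\<in>feasible M x. bellman_int M (opt_value M) x a) = (SUP a\<in>feasible M x. bellman_int M \<psi> x a)"
      by (intro SUP_cong refl bellman_int_cong eq x)
    then show ?thesis using eq[OF x] \<psi>(2)[OF x] by (simp add: bellman_op_def)
  qed
qed

text \<open>At a live state the value of the optimal policy is at most the one-step value of
  \<open>f x\<close> by \<open>superharmonic_first_step\<close> with \<open>W\<close> the optimal
  value; the Bellman equation gives the reverse inequality.\<close>

lemma optimal_selector_equation:
  assumes f: "f \<in> selectors M" and opt: "optimal M (stationary M f)"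
  shows "selector_equation M f (opt_value M)"
  unfolding selector_equation_iff[OF f]
proof
  note V = opt_value_unit
  fix x assume x: "x \<in> states M"
  show "opt_value M x = indicator (target M) x + indicator (live M) x * bellman_int M (opt_value M) x (f x)"
  proof (cases "x \<in> live M")
    case True
    interpret P: markov_process M "\<lambda>t x. return (action_space M) (f x)" x
      using model stationary_kernel[OF f] x by unfold_locales
    have fx: "f x \<in> feasible M x" using f True by (simp add: selectors_def)
    have "ennreal (reach_prob M (stationary M f) x) \<le> indicator (target M) x +
        kernel_value M (\<lambda>x. return (action_space M) (f x)) (\<lambda>y. ennreal (opt_value M y)) x"
      unfolding stationary_def
      by (rule P.superharmonic_first_step[OF measurable_ennreal_unit[OF V(1)]])
        (rule solution_superharmonic[OF V stationary_kernel[OF f]])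
    then have "ennreal (opt_value M x) \<le> ennreal (bellman_int M (opt_value M) x (f x))"
      using opt x True unfolding optimal_def kernel_value_stationary[OF f V(1) True]
      by (simp add: live_def)
    then have "opt_value M x \<le> bellman_int M (opt_value M) x (f x)"
      using bellman_int_bounds(1)[OF V(1) x fx] by (simp add: ennreal_le_iff)
    moreover have "bellman_int M (opt_value M) x (f x) \<le> opt_value M x"
      using bellman_int_le_bellman_op[OF V(1) True fx] V(2)[OF x] by simp
    ultimately show ?thesis using True by (simp add: live_def)
  next
    case False
    then show ?thesis using V(2)[OF x] by (simp add: bellman_op_not_live)
  qed
qed

end

theorem theorem2p10:
  fixes M :: "('x::polish_space, 'a::polish_space) reach_avoid"
  assumes model: "reach_avoid_model M"
    and compact_valued: "\<And>x. x \<in> live M \<Longrightarrow> compact (feasible M x)"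
    and uhc: "upper_hemicontinuous (live M) (actions M) (feasible M)"
    and wmeas: "weakly_measurable (live M) (actions M) (feasible M)"
    and feller: "strongly_Feller M"
    and exits: "\<And>\<pi> x. \<pi> \<in> markov_policies M \<Longrightarrow> x \<in> states M \<Longrightarrow>
                  AE \<omega> in process_law M \<pi> x. min (tau M \<omega>) (tau' M \<omega>) < \<infinity>"
  shows
    "(bellman_solution M (opt_value M) \<and>
      opt_value M \<in> B_bar M \<inter> bdd_meas_nonneg M \<and>
      (\<forall>\<psi> \<in> B_bar M \<inter> bdd_meas_nonneg M.
         bellman_solution M \<psi> \<longrightarrow> (\<forall>x\<in>states M. opt_value M x \<le> \<psi> x))) \<and>
     (\<exists>f \<in> selectors M.
        (\<forall>x\<in>live M. attains_max M (opt_value M) x (f x)) \<and>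
        selector_equation M f (opt_value M) \<and>
        optimal M (stationary M f)) \<and>
     (\<forall>f \<in> selectors M.
        optimal M (stationary M f) \<longrightarrow> selector_equation M f (opt_value M))"
proof -
  interpret exiting_model M
    using model compact_valued uhc feller exits by unfold_locales
  note V = opt_value_unit
  have unit: "B_bar M \<inter> bdd_meas_nonneg M = unit_functions M"
    using model by (intro unit_functions_eq) (simp add: reach_avoid_model_def)
  have sol: "bellman_solution M (opt_value M)"
    unfolding bellman_solution_iff[OF V(1)] using V(2) by blast
  have min: "opt_value M x \<le> \<psi> x" if "\<psi> \<in> unit_functions M" "bellman_solution M \<psi>" "x \<in> states M" for \<psi> x
    using that bellman_solution_iff[OF that(1)] by (intro opt_value_le_solution) blast+
  obtain f where f: "f \<in> selectors M" "\<And>x. x \<in> live M \<Longrightarrow> attains_max M (opt_value M) x (f x)"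
    using maximizing_selector[OF V(1)] by blast
  have opt: "optimal M (stationary M f)"
    unfolding optimal_def
    by (intro ballI maximizing_selector_attains[OF V f exits[OF stationary_policy[OF f(1)]]])
  \<comment> \<open>The equation for the maximizer is obtained from its optimality, through the
    converse statement.\<close>
  have "selector_equation M f (opt_value M)"
    by (rule optimal_selector_equation[OF f(1) opt])
  with f opt have "\<exists>f \<in> selectors M. (\<forall>x\<in>live M. attains_max M (opt_value M) x (f x)) \<and>
      selector_equation M f (opt_value M) \<and> optimal M (stationary M f)" by blast
  moreover have "\<forall>f \<in> selectors M. optimal M (stationary M f) \<longrightarrow> selector_equation M f (opt_value M)"
    using optimal_selector_equation by blast
  ultimately show ?thesis
    unfolding unit using sol V(1) min by blast
qed

end
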